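(* Let $\mathcal{B}\subseteq\mathcal{A}$ be a unital inclusion of finite-dimensional $C^*$-algebras. Then the following are equivalent: (i) $\mathcal{B}'\cap\mathcal{A}\subseteq\mathcal{B}$. (ii) $\mathcal{B}$ is a multiplicity free subalgebra of $\mathcal{A}$.
   Context: $\mathbb{N}=\{1,2,\dots\}$. $\mathcal{B}'\cap\mathcal{A}$ is the relative commutant of $\mathcal{B}$ in $\mathcal{A}$. For $\vec{n}=(n_1,\dots,n_l)\in\mathbb{N}^l$ put $\mathbb{M}_{\vec{n}}(\mathbb{C})=\bigoplus_{i=1}^l\mathbb{M}_{n_i}(\mathbb{C})$. Given $\vec{d}\in\mathbb{N}^k$ and an $l\times k$ matrix $\Lambda$ with entries in $\mathbb{N}\cup\{0\}$, with no zero row or zero column, and $\Lambda\vec{d}=\vec{n}$, define the injective unital $*$-homomorphism $\Phi_\Lambda:\mathbb{M}_{\vec{d}}(\mathbb{C})\to\mathbb{M}_{\vec{n}}(\mathbb{C})$ whose $i$-th component at $x=(x_1,\dots,x_k)$ is the block diagonal matrix $\bigoplus_{j=1}^k (x_j\otimes\mathbb{I}_{\Lambda_{ij}})$, where $x_j\otimes\mathbb{I}_p$ is the block diagonal matrix with $p$ diagonal blocks equal to $x_j$ (omitted if $p=0$). $\Lambda$ is called multiplicity free if $\sum_{i=1}^l\Lambda_{ij}\le 1$ for every $j=1,\dots,k$. Identify a finite-dimensional $C^*$-algebra $\mathcal{A}$ with some $\mathbb{M}_{\vec{n}}(\mathbb{C})$. A unital $C^*$-subalgebra $\mathcal{B}$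 of $\mathbb{M}_{\vec{n}}(\mathbb{C})$ is multiplicity free if there is a unitary $u\in\mathbb{M}_{\vec{n}}(\mathbb{C})$ with $u\mathcal{B}u^*=\Phi_\Lambda(\mathbb{M}_{\vec{d}}(\mathbb{C}))$ for some $k\in\mathbb{N}$, $\vec{d}\in\mathbb{N}^k$ and some multiplicity free $l\times k$ matrix $\Lambda$. *)

theory Defs
  imports "Jordan_Normal_Form.Schur_Decomposition"
begin

text \<open>
  Tuples $(n_1,\dots,n_l)$ are lists, so the indices $i$, $j$ start from 0. An element
  $(x_1,\dots,x_l)$ of a direct sum of matrix algebras is the list of its components, and all
  operations are componentwise.
\<close>

definition dim_vector :: "nat list \<Rightarrow> bool" where
  "dim_vector ns \<longleftrightarrow> ns \<noteq> [] \<and> (\<forall>n\<in>set ns. 1 \<le> n)"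

definition msum :: "nat list \<Rightarrow> complex mat list set" where
  "msum ns = {xs. length xs = length ns \<and> (\<forall>i<length ns. xs ! i \<in> carrier_mat (ns ! i) (ns ! i))}"

definition msum_one :: "nat list \<Rightarrow> complex mat list" where
  "msum_one ns = map 1\<^sub>m ns"

definition msum_add :: "complex mat list \<Rightarrow> complex mat list \<Rightarrow> complex mat list" where
  "msum_add xs ys = map2 (+) xs ys"

definition msum_mult :: "complex mat list \<Rightarrow> complex mat list \<Rightarrow> complex mat list" where
  "msum_mult xs ys = map2 (*) xs ys"

definition msum_smult :: "complex \<Rightarrow> complex mat list \<Rightarrow> complex mat list" where
  "msum_smult c xs = map (\<lambda>x. c \<cdot>\<^sub>m x) xs"

definition msum_star :: "complex mat list \<Rightarrow> complex mat list" where
  "msum_star xs = map mat_adjoint xs"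

definition msum_unitary :: "nat list \<Rightarrow> complex mat list \<Rightarrow> bool" where
  "msum_unitary ns u \<longleftrightarrow> u \<in> msum ns \<and>
     msum_mult u (msum_star u) = msum_one ns \<and> msum_mult (msum_star u) u = msum_one ns"

text \<open>
  Norm-closedness of a C*-subalgebra is not listed, since every linear subspace of the
  finite-dimensional space \<^term>\<open>msum ns\<close> is closed.
\<close>

definition unital_cstar_subalgebra :: "nat list \<Rightarrow> complex mat list set \<Rightarrow> bool" where
  "unital_cstar_subalgebra ns B \<longleftrightarrow>
     B \<subseteq> msum ns \<and>
     msum_one ns \<in> B \<and>
     (\<forall>x\<in>B. \<forall>y\<in>B. msum_add x y \<in> B) \<and>
     (\<forall>c. \<forall>x\<in>B. msum_smult c x \<in> B) \<and>
     (\<forall>x\<in>B. \<forall>y\<in>B. msum_mult x y \<in> B) \<and>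
     (\<forall>x\<in>B. msum_star x \<in> B)"

definition relative_commutant ::
    "complex mat list set \<Rightarrow> complex mat list set \<Rightarrow> complex mat list set" where
  "relative_commutant B A = {a \<in> A. \<forall>b\<in>B. msum_mult a b = msum_mult b a}"

definition inclusion_matrix :: "nat mat \<Rightarrow> nat list \<Rightarrow> nat list \<Rightarrow> bool" where
  "inclusion_matrix \<Lambda> ds ns \<longleftrightarrow>
     \<Lambda> \<in> carrier_mat (length ns) (length ds) \<and>
     (\<forall>i<length ns. row \<Lambda> i \<noteq> 0\<^sub>v (length ds)) \<and>
     (\<forall>j<length ds. col \<Lambda> j \<noteq> 0\<^sub>v (length ns)) \<and>
     \<Lambda> *\<^sub>v vec_of_list ds = vec_of_list ns"

text \<open>
  The matrix $x\otimes I_p$; for $p=0$ it is the $0\times 0$ matrix, which contributes nothing to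
  an enclosing \<^const>\<open>diag_block_mat\<close>.
\<close>

definition amplify :: "complex mat \<Rightarrow> nat \<Rightarrow> complex mat" where
  "amplify x p = diag_block_mat (replicate p x)"

definition Phi :: "nat mat \<Rightarrow> complex mat list \<Rightarrow> complex mat list" where
  "Phi \<Lambda> xs =
     map (\<lambda>i. diag_block_mat (map (\<lambda>j. amplify (xs ! j) (\<Lambda> $$ (i, j))) [0..<dim_col \<Lambda>]))
       [0..<dim_row \<Lambda>]"

definition multiplicity_free_matrix :: "nat mat \<Rightarrow> bool" where
  "multiplicity_free_matrix \<Lambda> \<longleftrightarrow> (\<forall>j<dim_col \<Lambda>. (\<Sum>i<dim_row \<Lambda>. \<Lambda> $$ (i, j)) \<le> 1)"

definition multiplicity_free_subalgebra :: "nat list \<Rightarrow> complex mat list set \<Rightarrow> bool" where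
  "multiplicity_free_subalgebra ns B \<longleftrightarrow>
     (\<exists>u ds \<Lambda>. msum_unitary ns u \<and> dim_vector ds \<and> inclusion_matrix \<Lambda> ds ns \<and>
        multiplicity_free_matrix \<Lambda> \<and>
        (\<lambda>b. msum_mult (msum_mult u b) (msum_star u)) ` B = Phi \<Lambda> ` msum ds)"

end

theory Submission
  imports Defs "Jordan_Normal_Form.Spectral_Radius"
begin

text \<open>
  If \<open>\<B>\<close> is multiplicity free, then up to a unitary it contains every diagonal element of
  \<open>\<A>\<close>. The diagonal elements form a maximal abelian subalgebra, so the relative commutant of
  \<open>\<B>\<close> consists of diagonal elements and lies in \<open>\<B>\<close>.

  Conversely, decompose each summand of \<open>\<A>\<close>, as a \<open>\<B>\<close>-module, into an orthogonal sum of
  irreducible modules. The projections onto these submodules commute with \<open>\<B>\<close>, so under (i) they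
  belong to \<open>\<B>\<close>; hence \<open>\<B>\<close> is the direct sum of its compressions to the submodules. Each
  compression is a star-algebra with scalar commutant, hence a full matrix algebra, and \<open>\<B>\<close> is
  the algebra of all block diagonal elements. No two of the submodules are isomorphic, because
  \<open>\<B>\<close> contains their projections.
\<close>

section \<open>Orthonormal families of functions on a finite set\<close>

text \<open>That the submodules are pairwise non-isomorphic is never formulated. The candidate
  matrix gets one column for each submodule of each summand, with its single 1 in the row of that
  summand, so it is multiplicity free by construction, and \<open>B\<close> embeds into the algebra
  of all block diagonal elements. What has to be shown is that \<open>B\<close> fills this algebra:
  two isomorphic submodules, in one summand or in two different ones, would link the corresponding
  blocks of \<open>B\<close>. Condition (i) rules this out because the unit of a single block is
  central among the block diagonal elements, hence commutes with \<open>B\<close>. Irreducibility is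
  expressed as scalar commutant. In this form its failure hands over a non-scalar \<open>T\<close>,
  whose eigenspace splits the module, and its validity is exactly what the projection argument for
  fullness consumes. The splitting must be unitary and the projection orthogonal, so orthonormal
  bases are needed twice: in the space of vectors, and in the space of matrices with the
  Hilbert-Schmidt product. Hence the first section works with functions on an arbitrary finite index
  set.\<close>

definition cip :: "'a set \<Rightarrow> ('a \<Rightarrow> complex) \<Rightarrow> ('a \<Rightarrow> complex) \<Rightarrow> complex" where
  "cip I f g = (\<Sum>i\<in>I. f i * cnj (g i))"

definition orthonormal_on :: "'a set \<Rightarrow> nat \<Rightarrow> (nat \<Rightarrow> 'a \<Rightarrow> complex) \<Rightarrow> bool" where
  "orthonormal_on I m b \<longleftrightarrow> (\<forall>k<m. \<forall>l<m. cip I (b k) (b l) = (if k = l then 1 else 0))"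

text \<open>Elements are functions on the whole type, while \<open>cip\<close> sees only their
  values on the index set; expansions in a basis are therefore asserted only at points of that
  set.\<close>

definition function_subspace :: "('a \<Rightarrow> complex) set \<Rightarrow> bool" where
  "function_subspace V \<longleftrightarrow> V \<noteq> {} \<and> (\<forall>f\<in>V. \<forall>g\<in>V. \<forall>c. (\<lambda>i. f i + c * g i) \<in> V)"

lemma cip_commute: "cip I g f = cnj (cip I f g)"
  by (simp add: cip_def mult.commute)

lemma cip_diff_left: "cip I (\<lambda>i. f i - g i) h = cip I f h - cip I g h"
  by (simp add: cip_def left_diff_distrib sum_subtractf)

lemma cip_add_smult_left: "cip I (\<lambda>i. f i + c * g i) h = cip I f h + c * cip I g h"
  by (simp add: cip_def distrib_right sum.distrib sum_distrib_left mult.assoc)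

lemma cip_smult_left: "cip I (\<lambda>i. c * f i) g = c * cip I f g"
  by (simp add: cip_def sum_distrib_left mult.assoc)

lemma cip_smult_right: "cip I f (\<lambda>i. c * g i) = cnj c * cip I f g"
  by (simp add: cip_def sum_distrib_left mult_ac)

lemma cip_sum_left: "cip I (\<lambda>i. \<Sum>k\<in>K. a k * f k i) g = (\<Sum>k\<in>K. a k * cip I (f k) g)"
  unfolding cip_def sum_distrib_right sum_distrib_left
  by (subst sum.swap) (simp add: mult.assoc)

lemma cip_self: "cip I f f = of_real (\<Sum>i\<in>I. (cmod (f i))\<^sup>2)"
  unfolding cip_def of_real_sum by (rule sum.cong[OF refl complex_norm_square[symmetric]])

lemma cip_expansion:
  assumes "orthonormal_on I m b" "l < m"
  shows "cip I (\<lambda>i. \<Sum>k<m. a k * b k i) (b l) = a l"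
proof -
  have "cip I (\<lambda>i. \<Sum>k<m. a k * b k i) (b l) = (\<Sum>k<m. a k * cip I (b k) (b l))"
    by (rule cip_sum_left)
  also have "\<dots> = (\<Sum>k<m. if k = l then a l else 0)"
    using assms by (intro sum.cong) (auto simp: orthonormal_on_def)
  also have "\<dots> = a l" using assms(2) by simp
  finally show ?thesis .
qed

text \<open>Bessel's inequality for the indicator of a point \<open>t\<close>: its projection
  \<open>g\<close> onto the family has squared norm \<open>s t\<close>, which is also the value
  \<open>g t\<close>, and this forces \<open>s t\<close> to be at most 1. Summing over
  \<open>t\<close> counts each unit vector once. The bound is what makes a family of greatest size
  exist.\<close>

lemma orthonormal_on_le_card:
  assumes fin: "finite I" and on: "orthonormal_on I m b"
  shows "m \<le> card I"
proof -
  define s where "s t = (\<Sum>k<m. (cmod (b k t))\<^sup>2)" for t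
  have s1: "s t \<le> 1" if t: "t \<in> I" for t
  proof -
    define g where "g = (\<lambda>i. \<Sum>k<m. cnj (b k t) * b k i)"
    have gt: "g t = of_real (s t)"
      unfolding g_def s_def of_real_sum
      by (rule sum.cong[OF refl]) (simp only: complex_norm_square mult.commute)
    have "cip I g g = (\<Sum>k<m. cnj (b k t) * cip I (b k) g)"
      unfolding g_def by (rule cip_sum_left)
    also have "\<dots> = (\<Sum>k<m. cnj (b k t) * b k t)"
    proof (rule sum.cong)
      fix k assume "k \<in> {..<m}"
      then have "cip I g (b k) = cnj (b k t)"
        unfolding g_def using cip_expansion[OF on] by simp
      then show "cnj (b k t) * cip I (b k) g = cnj (b k t) * b k t"
        by (subst cip_commute) simp
    qed simp
    also have "\<dots> = of_real (s t)"
      using gt by (simp add: g_def)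
    finally have "(\<Sum>i\<in>I. (cmod (g i))\<^sup>2) = s t"
      unfolding cip_self by (simp only: of_real_eq_iff)
    moreover have "(cmod (g t))\<^sup>2 \<le> (\<Sum>i\<in>I. (cmod (g i))\<^sup>2)"
      using fin t by (intro member_le_sum) auto
    ultimately have "(s t)\<^sup>2 \<le> s t" by (simp add: gt)
    then show ?thesis
      using mult_strict_left_mono[of 1 "s t" "s t"] by (fastforce simp: power2_eq_square)
  qed
  have "of_nat m = (\<Sum>k<m. cip I (b k) (b k))"
    using on by (simp add: orthonormal_on_def)
  also have "\<dots> = of_real (\<Sum>k<m. \<Sum>t\<in>I. (cmod (b k t))\<^sup>2)"
    by (simp only: cip_self of_real_sum)
  also have "(\<Sum>k<m. \<Sum>t\<in>I. (cmod (b k t))\<^sup>2) = (\<Sum>t\<in>I. s t)"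
    unfolding s_def by (rule sum.swap)
  finally have "complex_of_real (real m) = of_real (\<Sum>t\<in>I. s t)" by simp
  then have "real m = (\<Sum>t\<in>I. s t)" by (simp only: of_real_eq_iff)
  also have "\<dots> \<le> real (card I)"
    using sum_mono[of I s "\<lambda>_. 1"] s1 by simp
  finally show ?thesis by simp
qed

lemma function_subspace_smult:
  assumes "function_subspace V" "f \<in> V"
  shows "(\<lambda>i. c * f i) \<in> V"
proof -
  have "(\<lambda>i. f i + (c - 1) * f i) \<in> V"
    using assms unfolding function_subspace_def by blast
  moreover have "(\<lambda>i. f i + (c - 1) * f i) = (\<lambda>i. c * f i)"
    by (simp add: algebra_simps)
  ultimately show ?thesis by simp
qed

lemma function_subspace_zero:
  assumes "function_subspace V"
  shows "(\<lambda>i. 0) \<in> V"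
proof -
  obtain f where "f \<in> V" using assms unfolding function_subspace_def by blast
  from function_subspace_smult[OF assms this, of 0] show ?thesis by simp
qed

lemma function_subspace_sum:
  assumes V: "function_subspace V" and "\<And>k. k < (m::nat) \<Longrightarrow> b k \<in> V"
  shows "(\<lambda>i. \<Sum>k<m. a k * b k i) \<in> V"
  using assms(2)
proof (induction m)
  case 0
  then show ?case using function_subspace_zero[OF V] by simp
next
  case (Suc m)
  then have "(\<lambda>i. \<Sum>k<m. a k * b k i) \<in> V" "b m \<in> V" by auto
  with V show ?case unfolding function_subspace_def by simp
qed

text \<open>An orthonormal family of greatest size in \<open>V\<close> must already span: a function
  it fails to reproduce leaves a nonzero residual orthogonal to the family, which can be normalised
  and appended.\<close>

lemma orthonormal_basis_exists:
  assumes fin: "finite I" and V: "function_subspace V"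
  obtains m b where "orthonormal_on I m b" "\<And>k. k < m \<Longrightarrow> b k \<in> V"
    "\<And>f i. f \<in> V \<Longrightarrow> i \<in> I \<Longrightarrow> f i = (\<Sum>k<m. cip I f (b k) * b k i)"
proof -
  define P where "P m \<longleftrightarrow> (\<exists>b. orthonormal_on I m b \<and> (\<forall>k<m. b k \<in> V))" for m
  have "P 0" by (simp add: P_def orthonormal_on_def)
  moreover have bound: "m \<le> card I" if "P m" for m
    using that orthonormal_on_le_card[OF fin] unfolding P_def by blast
  ultimately obtain m where m: "P m" and max: "\<And>m'. P m' \<Longrightarrow> m' \<le> m"
    using GreatestI_nat[of P 0 "card I"] Greatest_le_nat[of P _ "card I"] by metis
  from m obtain b where on: "orthonormal_on I m b" and bV: "\<And>k. k < m \<Longrightarrow> b k \<in> V"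
    unfolding P_def by blast
  have "f i = (\<Sum>k<m. cip I f (b k) * b k i)" if f: "f \<in> V" and i: "i \<in> I" for f i
  proof (rule ccontr)
    assume neq: "f i \<noteq> (\<Sum>k<m. cip I f (b k) * b k i)"
    define g where "g = (\<lambda>i. \<Sum>k<m. cip I f (b k) * b k i)"
    define r where "r = (\<lambda>i. f i - g i)"
    have "g \<in> V" unfolding g_def by (rule function_subspace_sum[OF V bV])
    then have "(\<lambda>i. f i + (-1) * g i) \<in> V"
      using V f unfolding function_subspace_def by blast
    then have rV: "r \<in> V" by (simp add: r_def)
    have r0: "cip I r (b l) = 0" if "l < m" for l
      unfolding r_def cip_diff_left g_def cip_expansion[OF on that] by simp
    define q where "q = (\<Sum>i\<in>I. (cmod (r i))\<^sup>2)"
    have "(cmod (r i))\<^sup>2 > 0" using neq by (simp add: r_def g_def)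
    moreover have "(cmod (r i))\<^sup>2 \<le> q"
      unfolding q_def using fin i by (intro member_le_sum) auto
    ultimately have q: "q > 0" by linarith
    define c where "c = complex_of_real (1 / sqrt q)"
    define b' where "b' = b(m := (\<lambda>i. c * r i))"
    have cc: "c * cnj c * of_real q = 1"
      using q by (simp add: c_def flip: of_real_mult)
    have "orthonormal_on I (Suc m) b'"
      unfolding orthonormal_on_def
    proof (intro allI impI)
      fix k l assume kl: "k < Suc m" "l < Suc m"
      consider "k < m" "l < m" | "k < m" "l = m" | "k = m" "l < m" | "k = m" "l = m"
        using kl by linarith
      then show "cip I (b' k) (b' l) = (if k = l then 1 else 0)"
      proof cases
        case 1
        with on show ?thesis by (simp add: b'_def orthonormal_on_def)
      next
        case 2
        have "cip I (b k) r = 0" using r0[OF 2(1)] cip_commute[of I "b k" r] by simp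
        with 2 show ?thesis by (simp add: b'_def cip_smult_right)
      next
        case 3
        with r0 show ?thesis by (simp add: b'_def cip_smult_left)
      next
        case 4
        then show ?thesis
          using cc by (simp add: b'_def cip_smult_left cip_smult_right cip_self q_def mult_ac)
      qed
    qed
    moreover have "\<forall>k<Suc m. b' k \<in> V"
      using bV function_subspace_smult[OF V rV] by (auto simp: b'_def less_Suc_eq)
    ultimately have "P (Suc m)" unfolding P_def by blast
    from max[OF this] show False by simp
  qed
  with on bV that show ?thesis by blast
qed

text \<open>The family joins a basis of \<open>V\<close> with one of its orthogonal complement. That
  the sizes add up to \<open>card I\<close> is a trace computation: the two projections sum to the
  identity, whose trace is \<open>card I\<close>, while each unit vector contributes 1.\<close>

lemma orthonormal_split:
  assumes fin: "finite I" and V: "function_subspace V"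
  obtains m n b where "m + n = card I" "orthonormal_on I (m + n) b"
    "\<And>k. k < m \<Longrightarrow> b k \<in> V"
    "\<And>k f. m \<le> k \<Longrightarrow> k < m + n \<Longrightarrow> f \<in> V \<Longrightarrow> cip I f (b k) = 0"
proof -
  define W where "W = {g. \<forall>f\<in>V. cip I g f = 0}"
  have W: "function_subspace W"
    unfolding function_subspace_def
  proof (intro conjI ballI allI)
    have "(\<lambda>i. 0) \<in> W" by (simp add: W_def cip_def)
    then show "W \<noteq> {}" by blast
  qed (simp add: W_def cip_add_smult_left)
  obtain m b where on: "orthonormal_on I m b" and bV: "\<And>k. k < m \<Longrightarrow> b k \<in> V"
    and rep: "\<And>f i. f \<in> V \<Longrightarrow> i \<in> I \<Longrightarrow> f i = (\<Sum>k<m. cip I f (b k) * b k i)"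
    using orthonormal_basis_exists[OF fin V] by metis
  obtain n c where on': "orthonormal_on I n c" and cW: "\<And>k. k < n \<Longrightarrow> c k \<in> W"
    and rep': "\<And>f i. f \<in> W \<Longrightarrow> i \<in> I \<Longrightarrow> f i = (\<Sum>k<n. cip I f (c k) * c k i)"
    using orthonormal_basis_exists[OF fin W] by metis
  define d where "d k = (if k < m then b k else c (k - m))" for k
  have orth: "cip I (b k) (c l) = 0" "cip I (c l) (b k) = 0" if "k < m" "l < n" for k l
    using that bV cW cip_commute[of I "b k" "c l"] by (auto simp: W_def)
  have "orthonormal_on I (m + n) d"
    using on on' orth by (auto simp: orthonormal_on_def d_def)
  moreover have "d k \<in> V" if "k < m" for k
    using that bV by (simp add: d_def)
  moreover have "cip I f (d k) = 0" if "m \<le> k" "k < m + n" "f \<in> V" for k f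
    using that cW[of "k - m"] cip_commute[of I f "d k"] by (auto simp: W_def d_def)
  moreover have "m + n = card I"
  proof -
    \<comment> \<open>The diagonal entry at \<open>t\<close> of the sum of the two
      projections.\<close>
    have one: "(\<Sum>k<m. cnj (b k t) * b k t) + (\<Sum>k<n. cnj (c k t) * c k t) = 1"
      if t: "t \<in> I" for t
    proof -
      define e where "e = (\<lambda>i. if i = t then 1 else 0 :: complex)"
      have e: "cip I e g = cnj (g t)" for g
        using fin t by (simp add: cip_def e_def if_distrib[of "\<lambda>x. x * _"] cong: if_cong)
      define g where "g = (\<lambda>i. \<Sum>k<m. cnj (b k t) * b k i)"
      \<comment> \<open>The part of the indicator of \<open>t\<close> that is orthogonal to
        \<open>V\<close>; its expansion in the basis of \<open>W\<close> supplies the second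
        projection.\<close>
      define r where "r = (\<lambda>i. e i - g i)"
      have r0: "cip I r (b l) = 0" if "l < m" for l
        unfolding r_def cip_diff_left g_def cip_expansion[OF on that] e by simp
      have "r \<in> W"
        unfolding W_def
      proof (intro CollectI ballI)
        fix f assume f: "f \<in> V"
        have "cip I f r = cip I (\<lambda>i. \<Sum>k<m. cip I f (b k) * b k i) r"
          unfolding cip_def[of I _ r] using rep[OF f] by (intro sum.cong) auto
        also have "\<dots> = (\<Sum>k<m. cip I f (b k) * cip I (b k) r)" by (rule cip_sum_left)
        also have "\<dots> = 0"
        proof (intro sum.neutral ballI)
          fix k assume "k \<in> {..<m}"
          then show "cip I f (b k) * cip I (b k) r = 0"
            using r0[of k] cip_commute[of I "b k" r] by simp
        qed
        finally show "cip I r f = 0" using cip_commute[of I r f] by simp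
      qed
      from rep'[OF this t] have "r t = (\<Sum>k<n. cip I r (c k) * c k t)" .
      also have "\<dots> = (\<Sum>k<n. cnj (c k t) * c k t)"
      proof (rule sum.cong)
        fix k assume k: "k \<in> {..<n}"
        have "cip I g (c k) = (\<Sum>l<m. cnj (b l t) * cip I (b l) (c k))"
          unfolding g_def by (rule cip_sum_left)
        then have "cip I g (c k) = 0" using orth k by simp
        then show "cip I r (c k) * c k t = cnj (c k t) * c k t"
          by (simp add: r_def cip_diff_left e)
      qed simp
      finally show ?thesis by (simp add: r_def e_def g_def algebra_simps)
    qed
    have b1: "(\<Sum>t\<in>I. cnj (b k t) * b k t) = 1" if "k < m" for k
      using on that by (simp add: orthonormal_on_def cip_def mult.commute)
    have c1: "(\<Sum>t\<in>I. cnj (c k t) * c k t) = 1" if "k < n" for k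
      using on' that by (simp add: orthonormal_on_def cip_def mult.commute)
    have "of_nat (card I) =
      (\<Sum>t\<in>I. (\<Sum>k<m. cnj (b k t) * b k t) + (\<Sum>k<n. cnj (c k t) * c k t))"
      using one by simp
    also have "\<dots> = (\<Sum>k<m. \<Sum>t\<in>I. cnj (b k t) * b k t) + (\<Sum>k<n. \<Sum>t\<in>I. cnj (c k t) * c k t)"
      unfolding sum.distrib by (intro arg_cong2[where f = "(+)"] sum.swap)
    also have "\<dots> = of_nat (m + n)" using b1 c1 by simp
    finally show ?thesis by (simp only: of_nat_eq_iff)
  qed
  ultimately show ?thesis using that by blast
qed

section \<open>Adjoints and unitary matrices\<close>

lemma dim_mat_adjoint [simp]:
  "dim_row (mat_adjoint A) = dim_col A" "dim_col (mat_adjoint A) = dim_row A"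
  by (simp_all add: mat_adjoint_def)

lemma mat_adjoint_carrier [simp]: "A \<in> carrier_mat m n \<Longrightarrow> mat_adjoint A \<in> carrier_mat n m"
  by auto

lemma index_mat_adjoint [simp]:
  "i < dim_col A \<Longrightarrow> j < dim_row A \<Longrightarrow> mat_adjoint (A :: complex mat) $$ (i, j) = cnj (A $$ (j, i))"
  by (simp add: mat_adjoint_def mat_of_rows_index)

lemma mat_adjoint_adjoint [simp]: "mat_adjoint (mat_adjoint A) = (A :: complex mat)"
  by (rule eq_matI) auto

lemma mat_adjoint_mult:
  assumes "A \<in> carrier_mat m n" "B \<in> carrier_mat n p"
  shows "mat_adjoint (A * B) = mat_adjoint B * mat_adjoint (A :: complex mat)"
  using assms by (intro eq_matI) (auto simp: scalar_prod_def mult.commute)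

lemma mat_adjoint_one [simp]: "mat_adjoint (1\<^sub>m n) = (1\<^sub>m n :: complex mat)"
  by (rule eq_matI) auto

lemma mat_adjoint_four_block_diag:
  assumes "A \<in> carrier_mat m n" "D \<in> carrier_mat m' n'"
  shows "mat_adjoint (four_block_mat A (0\<^sub>m m n') (0\<^sub>m m' n) D) =
    four_block_mat (mat_adjoint A) (0\<^sub>m n m') (0\<^sub>m n' m) (mat_adjoint (D :: complex mat))"
  using assms by (intro eq_matI) auto

definition unitary_mat :: "nat \<Rightarrow> complex mat \<Rightarrow> bool" where
  "unitary_mat n U \<longleftrightarrow> U \<in> carrier_mat n n \<and> U * mat_adjoint U = 1\<^sub>m n \<and> mat_adjoint U * U = 1\<^sub>m n"

lemma unitary_matI:
  assumes "U \<in> carrier_mat n n" "U * mat_adjoint U = 1\<^sub>m n"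
  shows "unitary_mat n U"
  using assms mat_mult_left_right_inverse[of U n "mat_adjoint U"] by (simp add: unitary_mat_def)

lemma mult_four_block_diag:
  assumes "A \<in> carrier_mat m m" "A' \<in> carrier_mat m m" "D \<in> carrier_mat n n" "D' \<in> carrier_mat n n"
  shows "four_block_mat A (0\<^sub>m m n) (0\<^sub>m n m) D * four_block_mat A' (0\<^sub>m m n) (0\<^sub>m n m) D' =
    four_block_mat (A * A') (0\<^sub>m m n) (0\<^sub>m n m) (D * (D' :: complex mat))"
  using assms by (subst mult_four_block_mat[of _ m m _ n _ n _ _ m _ n]) auto

section \<open>Irreducible star-closed sets of matrices\<close>

text \<open>An eigenspace of \<open>T\<close> is invariant under \<open>S\<close>, and so is its orthogonal complement because
  \<open>S\<close> is closed under adjoints.\<close>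

lemma commutant_splitting:
  fixes S :: "complex mat set"
  assumes S: "S \<subseteq> carrier_mat n n" and star: "\<And>x. x \<in> S \<Longrightarrow> mat_adjoint x \<in> S"
    and n: "n > 0" and T: "T \<in> carrier_mat n n" and comm: "\<And>x. x \<in> S \<Longrightarrow> T * x = x * T"
    and nonscalar: "\<And>c. T \<noteq> c \<cdot>\<^sub>m 1\<^sub>m n"
  obtains U m m' where "unitary_mat n U" "n = m + m'" "m > 0" "m' > 0"
    "\<And>x i j. x \<in> S \<Longrightarrow> i < n \<Longrightarrow> j < n \<Longrightarrow> (i < m) \<noteq> (j < m) \<Longrightarrow>
      (U * x * mat_adjoint U) $$ (i, j) = 0"
proof -
  obtain c where "eigenvalue T c"
    using spectrum_non_empty[OF T] n by (auto simp: spectrum_def)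
  then obtain v where v: "v \<in> carrier_vec n" "v \<noteq> 0\<^sub>v n" "T *\<^sub>v v = c \<cdot>\<^sub>v v"
    using T by (auto simp: eigenvalue_def eigenvector_def)
  define V where "V = {f. T *\<^sub>v vec n f = c \<cdot>\<^sub>v vec n f}"
  have V: "function_subspace V"
    unfolding function_subspace_def
  proof (intro conjI ballI allI)
    have "vec n (\<lambda>i. v $ i) = v" using v(1) by auto
    with v(3) have "(\<lambda>i. v $ i) \<in> V" by (simp add: V_def)
    then show "V \<noteq> {}" by blast
    fix f g a assume f: "f \<in> V" and g: "g \<in> V"
    have "vec n (\<lambda>i. f i + a * g i) = vec n f + a \<cdot>\<^sub>v vec n g" by auto
    then show "(\<lambda>i. f i + a * g i) \<in> V"
      using f g T by (simp add: V_def mult_add_distrib_mat_vec[of T n n] mult_mat_vec[of T n n]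
          smult_add_distrib_vec[of _ n] smult_smult_assoc mult.commute)
  qed
  obtain m m' b where mm: "m + m' = n" and on: "orthonormal_on {..<n} n b"
    and bV: "\<And>k. k < m \<Longrightarrow> b k \<in> V"
    and bW: "\<And>k f. m \<le> k \<Longrightarrow> k < n \<Longrightarrow> f \<in> V \<Longrightarrow> cip {..<n} f (b k) = 0"
    using orthonormal_split[OF _ V, of "{..<n}"] by (metis card_lessThan finite_lessThan)
  \<comment> \<open>The rows are the conjugated basis vectors, so that entry \<open>(k, l)\<close>
    of the conjugate of \<open>x\<close> by \<open>U\<close> is the inner product of
    \<open>x\<close> applied to \<open>b l\<close> with \<open>b k\<close>.\<close>
  define U where "U = mat n n (\<lambda>(k, i). cnj (b k i))"
  have U: "U \<in> carrier_mat n n" by (simp add: U_def)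
  have colU: "col (mat_adjoint U) k = vec n (b k)" if "k < n" for k
    using that by (intro eq_vecI) (auto simp: U_def)
  have "U * mat_adjoint U = 1\<^sub>m n"
  proof (rule eq_matI)
    fix k l assume kl: "k < dim_row (1\<^sub>m n :: complex mat)" "l < dim_col (1\<^sub>m n :: complex mat)"
    then have "(U * mat_adjoint U) $$ (k, l) = cip {..<n} (b l) (b k)"
      by (simp add: U_def scalar_prod_def cip_def mult.commute atLeast0LessThan)
    with on kl show "(U * mat_adjoint U) $$ (k, l) = 1\<^sub>m n $$ (k, l)"
      by (simp add: orthonormal_on_def)
  qed (simp_all add: U_def)
  with U have unit: "unitary_mat n U" by (rule unitary_matI)
  have entry: "(U * x * mat_adjoint U) $$ (k, l) = cip {..<n} (\<lambda>i. (x *\<^sub>v vec n (b l)) $ i) (b k)"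
    if x: "x \<in> carrier_mat n n" and kl: "k < n" "l < n" for x k l
  proof -
    have "(U * x * mat_adjoint U) $$ (k, l) = (U * (x * mat_adjoint U)) $$ (k, l)"
      using U x by (simp add: assoc_mult_mat[of _ n n _ n _ n])
    also have "\<dots> = row U k \<bullet> col (x * mat_adjoint U) l" using U x kl by simp
    also have "col (x * mat_adjoint U) l = x *\<^sub>v vec n (b l)"
      using U x kl colU by (simp add: col_mult2[of _ n n _ n])
    also have "row U k \<bullet> (x *\<^sub>v vec n (b l)) = cip {..<n} (\<lambda>i. (x *\<^sub>v vec n (b l)) $ i) (b k)"
      using x kl by (simp add: U_def scalar_prod_def cip_def mult.commute atLeast0LessThan)
    finally show ?thesis .
  qed
  \<comment> \<open>\<open>x\<close> commutes with \<open>T\<close> and so keeps \<open>b l\<close>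
    inside the eigenspace, to which \<open>b k\<close> is orthogonal.\<close>
  have low: "(U * x * mat_adjoint U) $$ (k, l) = 0"
    if x: "x \<in> S" and kl: "m \<le> k" "k < n" "l < m" for x k l
  proof -
    have xc: "x \<in> carrier_mat n n" using x S by blast
    let ?w = "x *\<^sub>v vec n (b l)"
    have w: "vec n (\<lambda>i. ?w $ i) = ?w" using xc by auto
    have "T *\<^sub>v ?w = (T * x) *\<^sub>v vec n (b l)"
      using T xc by (simp add: assoc_mult_mat_vec[of _ n n _ n])
    also have "\<dots> = x *\<^sub>v (T *\<^sub>v vec n (b l))"
      using T xc comm[OF x] by (simp add: assoc_mult_mat_vec[of _ n n _ n])
    also have "\<dots> = c \<cdot>\<^sub>v ?w"
      using bV[OF kl(3)] xc by (simp add: V_def mult_mat_vec[of _ n n])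
    finally have "(\<lambda>i. ?w $ i) \<in> V" by (simp add: V_def w)
    with bW[OF kl(1,2)] show ?thesis using entry[OF xc kl(2), of l] kl by simp
  qed
  \<comment> \<open>The other off-diagonal block is the adjoint of the lower block belonging to the
    adjoint of \<open>x\<close>.\<close>
  have high: "(U * x * mat_adjoint U) $$ (k, l) = 0"
    if x: "x \<in> S" and kl: "k < m" "m \<le> l" "l < n" for x k l
  proof -
    have xc: "x \<in> carrier_mat n n" using x S by blast
    have "mat_adjoint (U * x * mat_adjoint U) = U * mat_adjoint x * mat_adjoint U"
      using U xc by (simp add: mat_adjoint_mult[of _ n n _ n] assoc_mult_mat[of _ n n _ n _ n])
    then have "mat_adjoint (U * x * mat_adjoint U) $$ (l, k) = 0"
      using low[OF star[OF x] kl(2,3,1)] by simp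
    then show ?thesis using U xc kl by simp
  qed
  \<comment> \<open>Otherwise every \<open>b k\<close> would be orthogonal to the eigenvector
    \<open>v\<close>, so the unitary \<open>U\<close> would kill \<open>v\<close>.\<close>
  have "m > 0"
  proof (rule ccontr)
    assume "\<not> m > 0"
    then have m0: "m = 0" by simp
    have vV: "(\<lambda>i. v $ i) \<in> V"
    proof -
      have "vec n (\<lambda>i. v $ i) = v" using v(1) by auto
      with v(3) show ?thesis by (simp add: V_def)
    qed
    have "U *\<^sub>v v = 0\<^sub>v n"
    proof (rule eq_vecI)
      fix k assume "k < dim_vec (0\<^sub>v n :: complex vec)"
      then have k: "k < n" by simp
      have "(U *\<^sub>v v) $ k = cip {..<n} (\<lambda>i. v $ i) (b k)"
        using k v(1) by (simp add: U_def scalar_prod_def cip_def mult.commute atLeast0LessThan)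
      with bW[OF _ k vV] m0 k show "(U *\<^sub>v v) $ k = 0\<^sub>v n $ k" by simp
    qed (use U in simp)
    moreover have "mat_adjoint U *\<^sub>v 0\<^sub>v n = 0\<^sub>v n"
      using U by (intro eq_vecI) (auto simp: scalar_prod_def)
    ultimately have "mat_adjoint U *\<^sub>v (U *\<^sub>v v) = 0\<^sub>v n" by simp
    then have "(mat_adjoint U * U) *\<^sub>v v = 0\<^sub>v n"
      using U v(1) by (simp add: assoc_mult_mat_vec[of _ n n _ n])
    with unit v show False by (simp add: unitary_mat_def)
  qed
  \<comment> \<open>Otherwise all columns of the adjoint of \<open>U\<close> would be eigenvectors
    for \<open>c\<close>, making \<open>T\<close> scalar.\<close>
  moreover have "m' > 0"
  proof (rule ccontr)
    assume "\<not> m' > 0"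
    with mm have mn: "m = n" by simp
    have "T * mat_adjoint U = c \<cdot>\<^sub>m mat_adjoint U"
    proof (rule mat_col_eqI)
      fix k assume "k < dim_col (c \<cdot>\<^sub>m mat_adjoint U)"
      then have k: "k < n" using U by simp
      have "col (T * mat_adjoint U) k = T *\<^sub>v vec n (b k)"
        using k T U colU by (simp add: col_mult2[of _ n n _ n])
      also have "\<dots> = c \<cdot>\<^sub>v vec n (b k)" using bV[of k] k mn by (simp add: V_def)
      also have "\<dots> = col (c \<cdot>\<^sub>m mat_adjoint U) k" using U k colU by simp
      finally show "col (T * mat_adjoint U) k = col (c \<cdot>\<^sub>m mat_adjoint U) k" .
    qed (use T U in auto)
    then have "T * mat_adjoint U * U = c \<cdot>\<^sub>m mat_adjoint U * U" by simp
    then have "T = c \<cdot>\<^sub>m 1\<^sub>m n"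
      using T U unit
      by (simp add: unitary_mat_def assoc_mult_mat[of _ n n _ n _ n] mult_smult_assoc_mat[of _ n n _ n])
    with nonscalar show False by blast
  qed
  ultimately show ?thesis
    using that[OF unit mm[symmetric]] low high by (meson not_le)
qed

lemma four_block_diagI:
  assumes "M \<in> carrier_mat (m + m') (m + m')"
    and "\<And>i j. i < m + m' \<Longrightarrow> j < m + m' \<Longrightarrow> (i < m) \<noteq> (j < m) \<Longrightarrow> M $$ (i, j) = 0"
  shows "M = four_block_mat (mat m m (\<lambda>(i, j). M $$ (i, j))) (0\<^sub>m m m') (0\<^sub>m m' m)
    (mat m' m' (\<lambda>(i, j). M $$ (m + i, m + j)))"
  using assms by (intro eq_matI) auto

text \<open>Strong induction on \<open>n\<close>: a non-scalar matrix commuting with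
  \<open>S\<close> splits the space into two smaller pieces, and otherwise the whole space is one
  block. Asking only for closure under adjoints lets the compressions of \<open>S\<close> to the two
  pieces qualify again. \<open>F x\<close> lists the diagonal blocks of \<open>x\<close> in the new
  basis.\<close>

lemma irreducible_decomposition:
  fixes S :: "complex mat set"
  assumes "S \<subseteq> carrier_mat n n" "\<And>x. x \<in> S \<Longrightarrow> mat_adjoint x \<in> S" "n > 0"
  shows "\<exists>U ds F. unitary_mat n U \<and> ds \<noteq> [] \<and> (\<forall>d\<in>set ds. 1 \<le> d) \<and> sum_list ds = n \<and>
    (\<forall>x\<in>S. F x \<in> msum ds \<and> U * x * mat_adjoint U = diag_block_mat (F x)) \<and>
    (\<forall>j<length ds. \<forall>T\<in>carrier_mat (ds ! j) (ds ! j).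
      (\<forall>x\<in>S. T * (F x ! j) = F x ! j * T) \<longrightarrow> (\<exists>c. T = c \<cdot>\<^sub>m 1\<^sub>m (ds ! j)))"
  using assms
proof (induction n arbitrary: S rule: less_induct)
  case (less n)
  note S = less.prems(1) and star = less.prems(2) and n = less.prems(3)
  show ?case
  proof (cases "\<forall>T\<in>carrier_mat n n. (\<forall>x\<in>S. T * x = x * T) \<longrightarrow> (\<exists>c. T = c \<cdot>\<^sub>m 1\<^sub>m n)")
    case True
    have "1\<^sub>m n * x * mat_adjoint (1\<^sub>m n) = diag_block_mat [x]" "[x] \<in> msum [n]" if "x \<in> S" for x
    proof -
      have "x \<in> carrier_mat n n" using S that by blast
      then show "1\<^sub>m n * x * mat_adjoint (1\<^sub>m n) = diag_block_mat [x]" "[x] \<in> msum [n]"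
        unfolding diag_block_mat_singleton by (simp_all add: msum_def)
    qed
    moreover have "unitary_mat n (1\<^sub>m n)" by (simp add: unitary_mat_def)
    ultimately show ?thesis
      using True n by (intro exI[of _ "1\<^sub>m n"] exI[of _ "[n]"] exI[of _ "\<lambda>x. [x]"]) auto
  next
    case False
    then obtain T where T: "T \<in> carrier_mat n n" "\<And>x. x \<in> S \<Longrightarrow> T * x = x * T"
      "\<And>c. T \<noteq> c \<cdot>\<^sub>m 1\<^sub>m n" by blast
    obtain U m m' where U: "unitary_mat n U" and mm: "n = m + m'" "m > 0" "m' > 0"
      and off: "\<And>x i j. x \<in> S \<Longrightarrow> i < n \<Longrightarrow> j < n \<Longrightarrow> (i < m) \<noteq> (j < m) \<Longrightarrow>
        (U * x * mat_adjoint U) $$ (i, j) = 0"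
      using commutant_splitting[OF S star n T] by blast
    have Uc: "U \<in> carrier_mat n n" using U by (simp add: unitary_mat_def)
    define p where "p x = mat m m (\<lambda>(i, j). (U * x * mat_adjoint U) $$ (i, j))" for x
    define q where "q x = mat m' m' (\<lambda>(i, j). (U * x * mat_adjoint U) $$ (m + i, m + j))" for x
    have pc: "p x \<in> carrier_mat m m" and qc: "q x \<in> carrier_mat m' m'" for x
      by (simp_all add: p_def q_def)
    have split: "U * x * mat_adjoint U = four_block_mat (p x) (0\<^sub>m m m') (0\<^sub>m m' m) (q x)"
      if x: "x \<in> S" for x
      unfolding p_def q_def using x S Uc off[OF x] unfolding mm(1) by (intro four_block_diagI) auto
    \<comment> \<open>Conjugation by \<open>U\<close> respects adjoints, hence so do the two
      compressions \<open>p\<close> and \<open>q\<close>; the induction hypothesis asks for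
      this.\<close>
    have adj: "U * mat_adjoint x * mat_adjoint U = mat_adjoint (U * x * mat_adjoint U)"
      if x: "x \<in> S" for x
    proof -
      have "x \<in> carrier_mat n n" using x S by blast
      then show ?thesis using Uc
        by (simp add: mat_adjoint_mult[of _ n n _ n] assoc_mult_mat[of _ n n _ n _ n])
    qed
    have padj: "mat_adjoint (p x) = p (mat_adjoint x)" and qadj: "mat_adjoint (q x) = q (mat_adjoint x)"
      if x: "x \<in> S" for x
      using x S Uc mm unfolding p_def q_def adj[OF x] by (auto intro: eq_matI)
    have pS: "p ` S \<subseteq> carrier_mat m m" "\<And>y. y \<in> p ` S \<Longrightarrow> mat_adjoint y \<in> p ` S"
      using pc padj star by auto
    have qS: "q ` S \<subseteq> carrier_mat m' m'" "\<And>y. y \<in> q ` S \<Longrightarrow> mat_adjoint y \<in> q ` S"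
      using qc qadj star by auto
    have "m < n" using mm by simp
    from less.IH[OF this pS mm(2)]
    obtain U1 ds1 F1 where 1: "unitary_mat m U1" "ds1 \<noteq> []" "\<forall>d\<in>set ds1. 1 \<le> d" "sum_list ds1 = m"
      and F1: "\<forall>x\<in>S. F1 (p x) \<in> msum ds1 \<and> U1 * p x * mat_adjoint U1 = diag_block_mat (F1 (p x))"
      and irr1: "\<forall>j<length ds1. \<forall>T\<in>carrier_mat (ds1 ! j) (ds1 ! j).
        (\<forall>x\<in>S. T * (F1 (p x) ! j) = F1 (p x) ! j * T) \<longrightarrow> (\<exists>c. T = c \<cdot>\<^sub>m 1\<^sub>m (ds1 ! j))"
      unfolding ball_simps(9) by blast
    have F1c: "F1 (p x) \<in> msum ds1"
      and F1d: "U1 * p x * mat_adjoint U1 = diag_block_mat (F1 (p x))" if "x \<in> S" for x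
      using F1 that by auto
    have "m' < n" using mm by simp
    from less.IH[OF this qS mm(3)]
    obtain U2 ds2 F2 where 2: "unitary_mat m' U2" "ds2 \<noteq> []" "\<forall>d\<in>set ds2. 1 \<le> d" "sum_list ds2 = m'"
      and F2: "\<forall>x\<in>S. F2 (q x) \<in> msum ds2 \<and> U2 * q x * mat_adjoint U2 = diag_block_mat (F2 (q x))"
      and irr2: "\<forall>j<length ds2. \<forall>T\<in>carrier_mat (ds2 ! j) (ds2 ! j).
        (\<forall>x\<in>S. T * (F2 (q x) ! j) = F2 (q x) ! j * T) \<longrightarrow> (\<exists>c. T = c \<cdot>\<^sub>m 1\<^sub>m (ds2 ! j))"
      unfolding ball_simps(9) by blast
    have F2c: "F2 (q x) \<in> msum ds2"
      and F2d: "U2 * q x * mat_adjoint U2 = diag_block_mat (F2 (q x))" if "x \<in> S" for x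
      using F2 that by auto
    \<comment> \<open>Acts separately on the two pieces, so conjugation by it refines the splitting
      by \<open>U\<close> without destroying it.\<close>
    define D where "D = four_block_mat U1 (0\<^sub>m m m') (0\<^sub>m m' m) U2"
    have U12: "U1 \<in> carrier_mat m m" "U2 \<in> carrier_mat m' m'"
      using 1(1) 2(1) by (simp_all add: unitary_mat_def)
    have Dc: "D \<in> carrier_mat n n" using U12 mm by (simp add: D_def)
    have Dadj: "mat_adjoint D = four_block_mat (mat_adjoint U1) (0\<^sub>m m m') (0\<^sub>m m' m) (mat_adjoint U2)"
      unfolding D_def by (rule mat_adjoint_four_block_diag[OF U12])
    have DD: "D * mat_adjoint D = 1\<^sub>m n"
      unfolding Dadj using U12 1(1) 2(1) mm
      by (simp add: D_def mult_four_block_diag unitary_mat_def)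
    define F where "F x = F1 (p x) @ F2 (q x)" for x
    have "unitary_mat n (D * U)"
    proof (rule unitary_matI)
      have "D * U * mat_adjoint (D * U) = D * (U * mat_adjoint U) * mat_adjoint D"
        using Dc Uc by (simp add: mat_adjoint_mult[of _ n n _ n] assoc_mult_mat[of _ n n _ n _ n]
            mult_carrier_mat[of _ n n _ n])
      then show "D * U * mat_adjoint (D * U) = 1\<^sub>m n"
        using U DD Dc by (simp add: unitary_mat_def)
    qed (use Dc Uc in simp)
    moreover have "F x \<in> msum (ds1 @ ds2)" if "x \<in> S" for x
      using F1c[OF that] F2c[OF that] by (auto simp: F_def msum_def nth_append)
    moreover have "(D * U) * x * mat_adjoint (D * U) = diag_block_mat (F x)" if x: "x \<in> S" for x
    proof -
      have xc: "x \<in> carrier_mat n n" using x S by blast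
      have "(D * U) * x * mat_adjoint (D * U) = D * (U * x * mat_adjoint U) * mat_adjoint D"
        using Dc Uc xc by (simp add: mat_adjoint_mult[of _ n n _ n] assoc_mult_mat[of _ n n _ n _ n]
            mult_carrier_mat[of _ n n _ n])
      also have "\<dots> = four_block_mat (U1 * p x * mat_adjoint U1) (0\<^sub>m m m') (0\<^sub>m m' m)
          (U2 * q x * mat_adjoint U2)"
        unfolding split[OF x] Dadj using U12 pc[of x] qc[of x]
        by (simp add: D_def mult_four_block_diag)
      also have "\<dots> = diag_block_mat (F x)"
      proof -
        have "diag_block_mat (F1 (p x)) \<in> carrier_mat m m"
          unfolding F1d[OF x, symmetric] using U12 pc[of x] by (simp add: mult_carrier_mat[of _ m m _ m])
        moreover have "diag_block_mat (F2 (q x)) \<in> carrier_mat m' m'"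
          unfolding F2d[OF x, symmetric] using U12 qc[of x] by (simp add: mult_carrier_mat[of _ m' m' _ m'])
        ultimately show ?thesis
          unfolding F1d[OF x] F2d[OF x] by (simp add: F_def diag_block_mat_append Let_def)
      qed
      finally show ?thesis .
    qed
    moreover have "\<exists>c. T = c \<cdot>\<^sub>m 1\<^sub>m ((ds1 @ ds2) ! j)"
      if j: "j < length (ds1 @ ds2)" and T: "T \<in> carrier_mat ((ds1 @ ds2) ! j) ((ds1 @ ds2) ! j)"
        and comm: "\<forall>x\<in>S. T * (F x ! j) = F x ! j * T" for j T
    proof (cases "j < length ds1")
      case True
      have "F x ! j = F1 (p x) ! j" if "x \<in> S" for x
        using F1c[OF that] True by (simp add: F_def msum_def nth_append)
      then show ?thesis using irr1 T comm True by (simp add: nth_append)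
    next
      case False
      then have j': "j - length ds1 < length ds2" using j by simp
      have "F x ! j = F2 (q x) ! (j - length ds1)" if "x \<in> S" for x
        using F1c[OF that] False by (simp add: F_def msum_def nth_append)
      then show ?thesis using irr2 j' T comm False by (simp add: nth_append)
    qed
    moreover have "ds1 @ ds2 \<noteq> []" "\<forall>d\<in>set (ds1 @ ds2). 1 \<le> d" "sum_list (ds1 @ ds2) = n"
      using 1 2 mm by auto
    ultimately show ?thesis by blast
  qed
qed

text \<open>The orthogonal projection of the matrix algebra onto \<open>C\<close>, for the Hilbert-Schmidt inner
  product, commutes with left multiplication by \<open>C\<close>. As \<open>C\<close> has scalar commutant, the projection is
  therefore right multiplication by some matrix, which is the identity since \<open>1 \<in> C\<close>.\<close>

lemma irreducible_star_algebra_full: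
  fixes C :: "complex mat set"
  assumes C: "C \<subseteq> carrier_mat d d" and one: "1\<^sub>m d \<in> C"
    and add: "\<And>x y. x \<in> C \<Longrightarrow> y \<in> C \<Longrightarrow> x + y \<in> C"
    and smult: "\<And>c x. x \<in> C \<Longrightarrow> c \<cdot>\<^sub>m x \<in> C"
    and mult: "\<And>x y. x \<in> C \<Longrightarrow> y \<in> C \<Longrightarrow> x * y \<in> C"
    and star: "\<And>x. x \<in> C \<Longrightarrow> mat_adjoint x \<in> C"
    and irr: "\<And>T. T \<in> carrier_mat d d \<Longrightarrow> (\<And>x. x \<in> C \<Longrightarrow> T * x = x * T) \<Longrightarrow> \<exists>c. T = c \<cdot>\<^sub>m 1\<^sub>m d"
  shows "C = carrier_mat d d"
proof -
  define I where "I = {..<d} \<times> {..<d}"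
  have fin: "finite I" by (simp add: I_def)
  have sumI: "(\<Sum>z\<in>I. f z) = (\<Sum>i<d. \<Sum>j<d. f (i, j))" for f :: "nat \<times> nat \<Rightarrow> complex"
    by (simp add: I_def sum.cartesian_product)
  define V where "V = {f. mat d d f \<in> C}"
  have V: "function_subspace V"
    unfolding function_subspace_def
  proof (intro conjI ballI allI)
    have "mat d d (\<lambda>(i, j). if i = j then 1 else 0 :: complex) = 1\<^sub>m d" by (intro eq_matI) auto
    then show "V \<noteq> {}" using one unfolding V_def by (metis empty_iff mem_Collect_eq)
    fix f g c assume fg: "f \<in> V" "g \<in> V"
    have "mat d d (\<lambda>i. f i + c * g i) = mat d d f + c \<cdot>\<^sub>m mat d d g" by (intro eq_matI) auto
    then show "(\<lambda>i. f i + c * g i) \<in> V" using fg add smult by (simp add: V_def)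
  qed
  obtain m b where on: "orthonormal_on I m b" and bV: "\<And>k. k < m \<Longrightarrow> b k \<in> V"
    and rep: "\<And>f i. f \<in> V \<Longrightarrow> i \<in> I \<Longrightarrow> f i = (\<Sum>k<m. cip I f (b k) * b k i)"
    using orthonormal_basis_exists[OF fin V] by metis
  \<comment> \<open>The kernel of the orthogonal projection of \<open>M\<^sub>d\<close> onto \<open>C\<close> for the Hilbert-Schmidt inner product.\<close>
  define K where "K x y = (\<Sum>k<m. cnj (b k y) * b k x)" for x y
  have proj: "(\<Sum>k<m. cip I f (b k) * b k x) = (\<Sum>y\<in>I. K x y * f y)" for f x
    unfolding K_def cip_def sum_distrib_right by (subst sum.swap) (simp add: mult_ac)
  have KV: "(\<lambda>x. K x y) \<in> V" for y
    unfolding K_def by (rule function_subspace_sum[OF V bV])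
  have repro: "f x = (\<Sum>y\<in>I. K x y * f y)" if "f \<in> V" "x \<in> I" for f x
    using rep[OF that] proj by simp
  have herm: "cnj (K x y) = K y x" for x y
    by (simp add: K_def mult.commute)
  \<comment> \<open>Kernels of the two composites of the projection with left multiplication by
    \<open>c\<close>: in \<open>L\<close> the multiplication comes after the projection, in
    \<open>R\<close> before it.\<close>
  define L where "L c x y = (\<Sum>s<d. c $$ (fst x, s) * K (s, snd x) y)" for c x y
  define R where "R c x y = (\<Sum>s<d. K x (s, snd y) * c $$ (s, fst y))" for c x y
  have LV: "(\<lambda>x. L c x y) \<in> V" if c: "c \<in> C" for c y
  proof -
    have "mat d d (\<lambda>x. L c x y) = c * mat d d (\<lambda>x. K x y)"
      using c C by (intro eq_matI) (auto simp: L_def scalar_prod_def atLeast0LessThan)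
    then show ?thesis using mult[OF c] KV[of y] by (simp add: V_def)
  qed
  \<comment> \<open>The projection is self-adjoint by \<open>herm\<close>, so taking adjoints
    exchanges the two orders and replaces \<open>c\<close> by its adjoint.\<close>
  have RL: "R c x y = cnj (L (mat_adjoint c) y x)" if c: "c \<in> C" and "x \<in> I" "y \<in> I" for c x y
  proof -
    have "c \<in> carrier_mat d d" using c C by blast
    then show ?thesis using that(2,3)
      by (auto simp: R_def L_def herm I_def mult.commute intro!: sum.cong)
  qed
  \<comment> \<open>With P the projection: cP has range in \<open>C\<close>, so cP = PcP. The same
    identity for the adjoint of \<open>c\<close> gives, after taking adjoints, Pc = PcP.\<close>
  have LR: "L c x y = R c x y" if c: "c \<in> C" and x: "x \<in> I" and y: "y \<in> I" for c x y
  proof -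
    have "L c x y = (\<Sum>z\<in>I. K x z * L c z y)" by (rule repro[OF LV[OF c] x])
    also have "\<dots> = (\<Sum>t<d. \<Sum>s<d. \<Sum>a<d. K x (s, t) * c $$ (s, a) * K (a, t) y)"
      unfolding sumI L_def by (subst sum.swap) (simp add: sum_distrib_left mult.assoc)
    also have "\<dots> = (\<Sum>t<d. \<Sum>a<d. \<Sum>s<d. K x (s, t) * c $$ (s, a) * K (a, t) y)"
      by (intro sum.cong[OF refl] sum.swap)
    also have "\<dots> = (\<Sum>z\<in>I. R c x z * K z y)"
      unfolding sumI R_def by (subst (3) sum.swap) (simp add: sum_distrib_right)
    also have "\<dots> = cnj (\<Sum>z\<in>I. K y z * L (mat_adjoint c) z x)"
      using RL[OF c x] by (simp add: herm mult.commute)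
    also have "\<dots> = cnj (L (mat_adjoint c) y x)"
      using repro[OF LV[OF star[OF c]] y] by simp
    finally show ?thesis using RL[OF c x y] by simp
  qed
  \<comment> \<open>For fixed column indices \<open>j\<close> and \<open>q\<close>, the kernel is a
    matrix in the row indices that commutes with \<open>C\<close>, hence scalar. So the projection
    only recombines columns, that is, it is a right multiplication.\<close>
  have "\<exists>r. \<forall>i<d. \<forall>p<d. K (i, j) (p, q) = (if i = p then r else 0)" if jq: "j < d" "q < d" for j q
  proof -
    define T where "T = mat d d (\<lambda>(i, p). K (i, j) (p, q))"
    have "T * c = c * T" if c: "c \<in> C" for c
    proof (rule eq_matI)
      have cc: "c \<in> carrier_mat d d" using c C by blast
      fix i p assume ip: "i < dim_row (c * T)" "p < dim_col (c * T)"
      then have "(T * c) $$ (i, p) = R c (i, j) (p, q)" "(c * T) $$ (i, p) = L c (i, j) (p, q)"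
        using cc by (auto simp: T_def R_def L_def scalar_prod_def atLeast0LessThan)
      then show "(T * c) $$ (i, p) = (c * T) $$ (i, p)"
        using LR[OF c, of "(i, j)" "(p, q)"] ip cc jq by (simp add: I_def T_def)
    qed (use c C in \<open>auto simp: T_def\<close>)
    then obtain r where r: "T = r \<cdot>\<^sub>m 1\<^sub>m d" using irr[of T] by (auto simp: T_def)
    have "K (i, j) (p, q) = (if i = p then r else 0)" if "i < d" "p < d" for i p
      using arg_cong[OF r, of "\<lambda>M. M $$ (i, p)"] that by (simp add: T_def)
    then show ?thesis by blast
  qed
  then obtain r where r: "\<And>i j p q. i < d \<Longrightarrow> j < d \<Longrightarrow> p < d \<Longrightarrow> q < d \<Longrightarrow>
    K (i, j) (p, q) = (if i = p then r j q else 0)" by metis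
  \<comment> \<open>The projection fixes the identity matrix, which determines the coefficients
    \<open>r\<close>.\<close>
  have r1: "r j i = (if i = j then 1 else 0)" if ij: "i < d" "j < d" for i j
  proof -
    define f where "f = (\<lambda>(i :: nat, j :: nat). if i = j then 1 else 0 :: complex)"
    have "mat d d f = 1\<^sub>m d" by (intro eq_matI) (auto simp: f_def)
    then have "f \<in> V" using one by (simp add: V_def)
    from repro[OF this, of "(i, j)"] ij
    have "f (i, j) = (\<Sum>p<d. \<Sum>q<d. K (i, j) (p, q) * f (p, q))"
      by (simp add: I_def sum.cartesian_product)
    also have "\<dots> = (\<Sum>p<d. \<Sum>q<d. if q = p then (if p = i then r j i else 0) else 0)"
      using ij by (intro sum.cong[OF refl]) (auto simp: r f_def)
    also have "\<dots> = r j i" using ij by simp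
    finally show ?thesis by (simp add: f_def)
  qed
  have "x \<in> C" if x: "x \<in> carrier_mat d d" for x
  proof -
    define f where "f = (\<lambda>(i, j). x $$ (i, j))"
    \<comment> \<open>The projection of \<open>x\<close>, which lies in \<open>V\<close> by
      construction and turns out to be \<open>x\<close> itself.\<close>
    define g where "g = (\<lambda>z. \<Sum>k<m. cip I f (b k) * b k z)"
    have "g \<in> V" unfolding g_def by (rule function_subspace_sum[OF V bV])
    moreover have "mat d d g = x"
    proof (rule eq_matI)
      fix i j assume "i < dim_row x" "j < dim_col x"
      then have ij: "i < d" "j < d" using x by auto
      have "g (i, j) = (\<Sum>p<d. \<Sum>q<d. K (i, j) (p, q) * x $$ (p, q))"
        unfolding g_def proj sumI by (simp add: f_def)
      also have "\<dots> = (\<Sum>p<d. \<Sum>q<d. if q = j then (if p = i then x $$ (i, j) else 0) else 0)"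
        using ij by (intro sum.cong[OF refl]) (auto simp: r r1)
      also have "\<dots> = x $$ (i, j)" using ij by simp
      finally show "mat d d g $$ (i, j) = x $$ (i, j)" using ij by simp
    qed (use x in auto)
    ultimately show ?thesis by (simp add: V_def)
  qed
  with C show ?thesis by blast
qed

section \<open>Direct sums of matrix algebras and the map \<open>\<Phi>\<close>\<close>

lemma msum_iff:
  "xs \<in> msum ns \<longleftrightarrow> length xs = length ns \<and> (\<forall>i<length ns. xs ! i \<in> carrier_mat (ns ! i) (ns ! i))"
  by (simp add: msum_def)

lemma msum_length: "xs \<in> msum ns \<Longrightarrow> length xs = length ns"
  by (simp add: msum_def)

lemma msum_nth: "xs \<in> msum ns \<Longrightarrow> i < length ns \<Longrightarrow> xs ! i \<in> carrier_mat (ns ! i) (ns ! i)"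
  by (simp add: msum_def)

lemma msum_eqI:
  "xs \<in> msum ns \<Longrightarrow> ys \<in> msum ns \<Longrightarrow> (\<And>i. i < length ns \<Longrightarrow> xs ! i = ys ! i) \<Longrightarrow> xs = ys"
  by (simp add: msum_def list_eq_iff_nth_eq)

lemma msum_closed:
  shows msum_add_closed: "xs \<in> msum ns \<Longrightarrow> ys \<in> msum ns \<Longrightarrow> msum_add xs ys \<in> msum ns"
    and msum_mult_closed: "xs \<in> msum ns \<Longrightarrow> ys \<in> msum ns \<Longrightarrow> msum_mult xs ys \<in> msum ns"
    and msum_smult_closed: "xs \<in> msum ns \<Longrightarrow> msum_smult c xs \<in> msum ns"
    and msum_star_closed: "xs \<in> msum ns \<Longrightarrow> msum_star xs \<in> msum ns"
  by (auto simp: msum_def msum_add_def msum_mult_def msum_smult_def msum_star_def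
      intro: mult_carrier_mat)

lemma msum_one_closed: "msum_one ns \<in> msum ns"
  by (simp add: msum_def msum_one_def)

lemma msum_op_nth:
  assumes "xs \<in> msum ns" "i < length ns"
  shows "ys \<in> msum ns \<Longrightarrow> msum_add xs ys ! i = xs ! i + ys ! i"
    and "ys \<in> msum ns \<Longrightarrow> msum_mult xs ys ! i = xs ! i * ys ! i"
    and "msum_smult c xs ! i = c \<cdot>\<^sub>m (xs ! i)"
    and "msum_star xs ! i = mat_adjoint (xs ! i)"
  using assms by (simp_all add: msum_def msum_add_def msum_mult_def msum_smult_def msum_star_def)

lemma msum_one_nth: "i < length ns \<Longrightarrow> msum_one ns ! i = 1\<^sub>m (ns ! i)"
  by (simp add: msum_one_def)

section \<open>Conjugation by a unitary of the direct sum\<close>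

definition msum_conj :: "complex mat list \<Rightarrow> complex mat list \<Rightarrow> complex mat list" where
  "msum_conj u x = msum_mult (msum_mult u x) (msum_star u)"

lemma msum_unitary_iff:
  "msum_unitary ns u \<longleftrightarrow> u \<in> msum ns \<and> (\<forall>i<length ns. unitary_mat (ns ! i) (u ! i))"
proof (cases "u \<in> msum ns")
  case True
  note [simp] = msum_closed msum_one_closed msum_op_nth[of _ ns] msum_one_nth
  have eq: "xs = ys \<longleftrightarrow> (\<forall>i<length ns. xs ! i = ys ! i)" if "xs \<in> msum ns" "ys \<in> msum ns" for xs ys
    using msum_eqI[OF that] by blast
  show ?thesis
    using True msum_nth[OF True] by (auto simp: msum_unitary_def eq unitary_mat_def)
qed (simp add: msum_unitary_def)

lemma msum_star_unitary:
  assumes "msum_unitary ns u" shows "msum_unitary ns (msum_star u)"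
  using assms by (auto simp: msum_unitary_iff unitary_mat_def msum_closed msum_op_nth[of _ ns])

lemma msum_star_star: "msum_star (msum_star u) = u"
  by (simp add: msum_star_def comp_def)

lemma msum_conj_closed:
  assumes "msum_unitary ns u" "x \<in> msum ns" shows "msum_conj u x \<in> msum ns"
  using assms by (simp add: msum_unitary_def msum_conj_def msum_closed)

lemma msum_conj_nth:
  assumes "msum_unitary ns u" "x \<in> msum ns" "i < length ns"
  shows "msum_conj u x ! i = u ! i * x ! i * mat_adjoint (u ! i)"
  using assms by (simp add: msum_unitary_def msum_conj_def msum_closed msum_op_nth[of _ ns])

lemma msum_conj_inverse:
  assumes u: "msum_unitary ns u" and x: "x \<in> msum ns"
  shows "msum_conj (msum_star u) (msum_conj u x) = x"
proof (rule msum_eqI)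
  note u' = msum_star_unitary[OF u]
  fix i assume i: "i < length ns"
  let ?n = "ns ! i" and ?U = "u ! i"
  have U: "unitary_mat ?n ?U" "?U \<in> carrier_mat ?n ?n" and xi: "x ! i \<in> carrier_mat ?n ?n"
    using u x i by (auto simp: msum_unitary_iff msum_nth)
  have "msum_conj (msum_star u) (msum_conj u x) ! i =
      mat_adjoint ?U * (?U * x ! i * mat_adjoint ?U) * ?U"
    using u x i
    by (simp add: msum_conj_nth[OF u'] msum_conj_nth[OF u] msum_conj_closed msum_op_nth[of _ ns]
        msum_unitary_iff)
  also have "\<dots> = mat_adjoint ?U * ?U * x ! i * (mat_adjoint ?U * ?U)"
    using U(2) xi
    by (simp add: assoc_mult_mat[of _ ?n ?n _ ?n _ ?n] mult_carrier_mat[of _ ?n ?n _ ?n])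
  also have "\<dots> = x ! i" using U xi by (simp add: unitary_mat_def)
  finally show "msum_conj (msum_star u) (msum_conj u x) ! i = x ! i" .
qed (use assms in \<open>auto intro!: msum_conj_closed msum_star_unitary\<close>)

lemma msum_conj_one:
  assumes u: "msum_unitary ns u"
  shows "msum_conj u (msum_one ns) = msum_one ns"
  using u
  by (auto intro!: msum_eqI[of _ ns] msum_conj_closed msum_one_closed
      simp: msum_conj_nth[OF u] msum_one_closed msum_one_nth msum_unitary_iff unitary_mat_def)

lemma msum_conj_hom:
  assumes u: "msum_unitary ns u" and x: "x \<in> msum ns" and y: "y \<in> msum ns"
  shows msum_conj_add: "msum_conj u (msum_add x y) = msum_add (msum_conj u x) (msum_conj u y)"
    and msum_conj_smult: "msum_conj u (msum_smult c x) = msum_smult c (msum_conj u x)"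
    and msum_conj_mult: "msum_conj u (msum_mult x y) = msum_mult (msum_conj u x) (msum_conj u y)"
    and msum_conj_star: "msum_conj u (msum_star x) = msum_star (msum_conj u x)"
proof -
  note closed = msum_conj_closed[OF u] msum_closed
  note nth = msum_conj_nth[OF u] msum_op_nth[of _ ns]
  {
    fix i assume i: "i < length ns"
    let ?n = "ns ! i"
    have U: "unitary_mat ?n (u ! i)" "u ! i \<in> carrier_mat ?n ?n"
      using u i by (auto simp: msum_unitary_iff msum_nth)
    have xy: "x ! i \<in> carrier_mat ?n ?n" "y ! i \<in> carrier_mat ?n ?n"
      using x y i by (auto simp: msum_nth)
    note assoc = assoc_mult_mat[of _ ?n ?n _ ?n _ ?n]
    have "u ! i * (x ! i + y ! i) * mat_adjoint (u ! i) =
        u ! i * x ! i * mat_adjoint (u ! i) + u ! i * y ! i * mat_adjoint (u ! i)"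
      using U(2) xy by (simp add: mult_add_distrib_mat[of _ ?n ?n _ ?n] add_mult_distrib_mat[of _ ?n ?n _ _ ?n])
    moreover have "u ! i * (c \<cdot>\<^sub>m (x ! i)) * mat_adjoint (u ! i) =
        c \<cdot>\<^sub>m (u ! i * x ! i * mat_adjoint (u ! i))"
      using U(2) xy by (simp add: mult_smult_distrib[of _ ?n ?n _ ?n] mult_smult_assoc_mat[of _ ?n ?n _ ?n])
    moreover have "u ! i * (x ! i * y ! i) * mat_adjoint (u ! i) =
        (u ! i * x ! i * mat_adjoint (u ! i)) * (u ! i * y ! i * mat_adjoint (u ! i))"
    proof -
      have "(u ! i * x ! i * mat_adjoint (u ! i)) * (u ! i * y ! i * mat_adjoint (u ! i)) =
          u ! i * x ! i * (mat_adjoint (u ! i) * u ! i) * y ! i * mat_adjoint (u ! i)"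
        using U(2) xy by (simp add: assoc mult_carrier_mat[of _ ?n ?n _ ?n])
      also have "\<dots> = u ! i * (x ! i * y ! i) * mat_adjoint (u ! i)"
        using U xy by (simp add: unitary_mat_def assoc)
      finally show ?thesis by simp
    qed
    moreover have "u ! i * mat_adjoint (x ! i) * mat_adjoint (u ! i) =
        mat_adjoint (u ! i * x ! i * mat_adjoint (u ! i))"
      using U(2) xy by (simp add: mat_adjoint_mult[of _ ?n ?n _ ?n] assoc)
    note calculation this
  } note comp = this
  show "msum_conj u (msum_add x y) = msum_add (msum_conj u x) (msum_conj u y)"
    "msum_conj u (msum_smult c x) = msum_smult c (msum_conj u x)"
    "msum_conj u (msum_mult x y) = msum_mult (msum_conj u x) (msum_conj u y)"
    "msum_conj u (msum_star x) = msum_star (msum_conj u x)"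
    using x y comp by (auto intro!: msum_eqI[of _ ns] simp: closed nth)
qed

section \<open>Block diagonal matrices and the homomorphism property of \<open>Phi\<close>\<close>

lemma diag_block_mat_map_carrier:
  "(\<And>j. j \<in> set js \<Longrightarrow> f j \<in> carrier_mat (d j) (d j)) \<Longrightarrow>
    diag_block_mat (map f js) \<in> carrier_mat (\<Sum>j\<leftarrow>js. d j) (\<Sum>j\<leftarrow>js. d j)"
  by (induction js) (auto simp: Let_def)

lemma diag_block_mat_map_one: "diag_block_mat (map (\<lambda>j. 1\<^sub>m (d j)) js) = 1\<^sub>m (\<Sum>j\<leftarrow>js. d j)"
  by (induction js) (auto simp: Let_def)

lemma diag_block_mat_map_hom:
  assumes "\<And>j. j \<in> set js \<Longrightarrow> f j \<in> carrier_mat (d j) (d j)"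
    and "\<And>j. j \<in> set js \<Longrightarrow> g j \<in> carrier_mat (d j) (d j)"
  shows "diag_block_mat (map (\<lambda>j. f j + g j) js) =
      diag_block_mat (map f js) + diag_block_mat (map g js)" (is ?add)
    and "diag_block_mat (map (\<lambda>j. f j * g j) js) =
      diag_block_mat (map f js) * (diag_block_mat (map g js) :: complex mat)" (is ?mult)
    and "diag_block_mat (map (\<lambda>j. c \<cdot>\<^sub>m f j) js) = c \<cdot>\<^sub>m diag_block_mat (map f js)" (is ?smult)
    and "diag_block_mat (map (\<lambda>j. mat_adjoint (f j)) js) =
      mat_adjoint (diag_block_mat (map f js))" (is ?adjoint)
proof -
  have "?add \<and> ?mult \<and> ?smult \<and> ?adjoint"
    using assms
  proof (induction js)
    case Nil
    then show ?case by (auto intro: eq_matI)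
  next
    case (Cons a js)
    let ?d = "d a" and ?s = "\<Sum>j\<leftarrow>js. d j"
    have fg: "f a \<in> carrier_mat ?d ?d" "g a \<in> carrier_mat ?d ?d"
      "diag_block_mat (map f js) \<in> carrier_mat ?s ?s" "diag_block_mat (map g js) \<in> carrier_mat ?s ?s"
      using Cons.prems by (auto intro!: diag_block_mat_map_carrier)
    have IH: "diag_block_mat (map (\<lambda>j. f j + g j) js) =
        diag_block_mat (map f js) + diag_block_mat (map g js)"
      "diag_block_mat (map (\<lambda>j. f j * g j) js) =
        diag_block_mat (map f js) * diag_block_mat (map g js)"
      "diag_block_mat (map (\<lambda>j. c \<cdot>\<^sub>m f j) js) = c \<cdot>\<^sub>m diag_block_mat (map f js)"
      "diag_block_mat (map (\<lambda>j. mat_adjoint (f j)) js) = mat_adjoint (diag_block_mat (map f js))"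
      using Cons by auto
    show ?case
      using fg
      by (simp add: Let_def IH add_four_block_mat[of _ ?d ?d _ ?s _ ?s] mult_four_block_diag
          smult_four_block_mat[of _ ?d ?d _ ?s _ ?s] mat_adjoint_four_block_diag)
  qed
  then show ?add ?mult ?smult ?adjoint by blast+
qed

text \<open>Writing the repetition as a map of a constant function lets the facts on
  \<open>diag_block_mat\<close> of mapped lists apply to \<open>amplify\<close>.\<close>

lemma amplify_conv_map: "amplify x p = diag_block_mat (map (\<lambda>_. x) [0..<p])"
  by (simp add: amplify_def map_replicate_const)

lemma amplify_carrier: "x \<in> carrier_mat d d \<Longrightarrow> amplify x p \<in> carrier_mat (p * d) (p * d)"
  using diag_block_mat_map_carrier[of "[0..<p]" "\<lambda>_. x" "\<lambda>_. d"]
  by (simp add: amplify_conv_map sum_list_triv)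

lemma amplify_one: "amplify (1\<^sub>m d) p = 1\<^sub>m (p * d)"
  using diag_block_mat_map_one[of "\<lambda>_. d" "[0..<p]"] by (simp add: amplify_conv_map sum_list_triv)

lemma amplify_hom:
  assumes "x \<in> carrier_mat d d" "y \<in> carrier_mat d d"
  shows "amplify (x + y) p = amplify x p + amplify y p"
    and "amplify (x * y) p = amplify x p * amplify y p"
    and "amplify (c \<cdot>\<^sub>m x) p = c \<cdot>\<^sub>m amplify x p"
    and "amplify (mat_adjoint x) p = mat_adjoint (amplify x p)"
  unfolding amplify_conv_map
  using diag_block_mat_map_hom[of "[0..<p]" "\<lambda>_. x" "\<lambda>_. d" "\<lambda>_. y"] assms by simp_all

lemma Phi_nth:
  "i < dim_row \<Lambda> \<Longrightarrow>
    Phi \<Lambda> xs ! i = diag_block_mat (map (\<lambda>j. amplify (xs ! j) (\<Lambda> $$ (i, j))) [0..<dim_col \<Lambda>])"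
  by (simp add: Phi_def)

text \<open>Row \<open>i\<close> of the equation between the dimension vectors, in the list form in
  which the size of a block diagonal matrix appears.\<close>

lemma inclusion_matrix_row_sum:
  assumes "inclusion_matrix \<Lambda> ds ns" "i < length ns"
  shows "(\<Sum>j\<leftarrow>[0..<length ds]. \<Lambda> $$ (i, j) * ds ! j) = ns ! i"
proof -
  have \<Lambda>: "\<Lambda> \<in> carrier_mat (length ns) (length ds)" and eq: "\<Lambda> *\<^sub>v vec_of_list ds = vec_of_list ns"
    using assms(1) by (auto simp: inclusion_matrix_def)
  have "ns ! i = (\<Lambda> *\<^sub>v vec_of_list ds) $ i" unfolding eq by (simp add: vec_of_list_index)
  also have "\<dots> = (\<Sum>j = 0..<length ds. \<Lambda> $$ (i, j) * ds ! j)"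
    using \<Lambda> assms(2) by (auto simp: scalar_prod_def vec_of_list_index intro!: sum.cong)
  also have "\<dots> = (\<Sum>j\<leftarrow>[0..<length ds]. \<Lambda> $$ (i, j) * ds ! j)"
    by (simp add: interv_sum_list_conv_sum_set_nat)
  finally show ?thesis by simp
qed

lemma Phi_closed:
  assumes inc: "inclusion_matrix \<Lambda> ds ns" and z: "z \<in> msum ds"
  shows "Phi \<Lambda> z \<in> msum ns"
  unfolding msum_iff
proof (intro conjI allI impI)
  have \<Lambda>: "dim_row \<Lambda> = length ns" "dim_col \<Lambda> = length ds"
    using inc by (auto simp: inclusion_matrix_def)
  show "length (Phi \<Lambda> z) = length ns" by (simp add: Phi_def \<Lambda>)
  fix i assume i: "i < length ns"
  have "Phi \<Lambda> z ! i \<in> carrier_mat (\<Sum>j\<leftarrow>[0..<length ds]. \<Lambda> $$ (i, j) * ds ! j)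
      (\<Sum>j\<leftarrow>[0..<length ds]. \<Lambda> $$ (i, j) * ds ! j)"
    using i z \<Lambda>
    by (simp add: Phi_nth) (auto intro!: diag_block_mat_map_carrier amplify_carrier msum_nth)
  then show "Phi \<Lambda> z ! i \<in> carrier_mat (ns ! i) (ns ! i)"
    unfolding inclusion_matrix_row_sum[OF inc i] .
qed

lemma Phi_one:
  assumes inc: "inclusion_matrix \<Lambda> ds ns"
  shows "Phi \<Lambda> (msum_one ds) = msum_one ns"
proof (rule msum_eqI)
  have \<Lambda>: "dim_row \<Lambda> = length ns" "dim_col \<Lambda> = length ds"
    using inc by (auto simp: inclusion_matrix_def)
  fix i assume i: "i < length ns"
  have "map (\<lambda>j. amplify (msum_one ds ! j) (\<Lambda> $$ (i, j))) [0..<length ds] =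
      map (\<lambda>j. 1\<^sub>m (\<Lambda> $$ (i, j) * ds ! j)) [0..<length ds]"
    by (simp add: msum_one_nth amplify_one)
  then have "Phi \<Lambda> (msum_one ds) ! i = 1\<^sub>m (\<Sum>j\<leftarrow>[0..<length ds]. \<Lambda> $$ (i, j) * ds ! j)"
    using i by (simp only: Phi_nth \<Lambda> diag_block_mat_map_one)
  then show "Phi \<Lambda> (msum_one ds) ! i = msum_one ns ! i"
    using i by (simp only: inclusion_matrix_row_sum[OF inc i] msum_one_nth)
qed (auto intro: Phi_closed[OF inc] msum_one_closed)

lemma Phi_hom:
  assumes inc: "inclusion_matrix \<Lambda> ds ns" and x: "x \<in> msum ds" and y: "y \<in> msum ds"
  shows Phi_add: "Phi \<Lambda> (msum_add x y) = msum_add (Phi \<Lambda> x) (Phi \<Lambda> y)"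
    and Phi_mult: "Phi \<Lambda> (msum_mult x y) = msum_mult (Phi \<Lambda> x) (Phi \<Lambda> y)"
    and Phi_smult: "Phi \<Lambda> (msum_smult c x) = msum_smult c (Phi \<Lambda> x)"
    and Phi_star: "Phi \<Lambda> (msum_star x) = msum_star (Phi \<Lambda> x)"
proof -
  have \<Lambda>: "dim_row \<Lambda> = length ns" "dim_col \<Lambda> = length ds"
    using inc by (auto simp: inclusion_matrix_def)
  note closed = Phi_closed[OF inc]
  {
    fix i assume i: "i < length ns"
    define d where "d j = \<Lambda> $$ (i, j) * ds ! j" for j
    define f where "f z j = amplify (z ! j) (\<Lambda> $$ (i, j))" for z j
    have nth: "Phi \<Lambda> z ! i = diag_block_mat (map (f z) [0..<length ds])" for z
      using i by (simp add: Phi_nth \<Lambda> f_def[abs_def])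
    have fc: "f z j \<in> carrier_mat (d j) (d j)" if "z \<in> msum ds" "j \<in> set [0..<length ds]" for z j
      using that by (auto simp: f_def d_def intro!: amplify_carrier msum_nth)
    have f: "f (msum_add x y) j = f x j + f y j" "f (msum_mult x y) j = f x j * f y j"
      "f (msum_smult c x) j = c \<cdot>\<^sub>m f x j" "f (msum_star x) j = mat_adjoint (f x j)"
      if "j \<in> set [0..<length ds]" for j
    proof -
      have j: "j < length ds" using that by simp
      show "f (msum_add x y) j = f x j + f y j" "f (msum_mult x y) j = f x j * f y j"
        "f (msum_smult c x) j = c \<cdot>\<^sub>m f x j" "f (msum_star x) j = mat_adjoint (f x j)"
        using amplify_hom[OF msum_nth[OF x j] msum_nth[OF y j]] x y j
        by (simp_all add: f_def msum_op_nth[of _ ds])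
    qed
    let ?map = "\<lambda>g. map g [0..<length ds]"
    have maps: "?map (f (msum_add x y)) = ?map (\<lambda>j. f x j + f y j)"
      "?map (f (msum_mult x y)) = ?map (\<lambda>j. f x j * f y j)"
      "?map (f (msum_smult c x)) = ?map (\<lambda>j. c \<cdot>\<^sub>m f x j)"
      "?map (f (msum_star x)) = ?map (\<lambda>j. mat_adjoint (f x j))"
      by (rule map_cong[OF refl], rule f, assumption)+
    have "Phi \<Lambda> (msum_add x y) ! i = Phi \<Lambda> x ! i + Phi \<Lambda> y ! i \<and>
      Phi \<Lambda> (msum_mult x y) ! i = Phi \<Lambda> x ! i * Phi \<Lambda> y ! i \<and>
      Phi \<Lambda> (msum_smult c x) ! i = c \<cdot>\<^sub>m Phi \<Lambda> x ! i \<and>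
      Phi \<Lambda> (msum_star x) ! i = mat_adjoint (Phi \<Lambda> x ! i)"
      using diag_block_mat_map_hom[of "[0..<length ds]" "f x" d "f y"] fc[OF x] fc[OF y]
      by (simp add: nth maps)
  }
  then show "Phi \<Lambda> (msum_add x y) = msum_add (Phi \<Lambda> x) (Phi \<Lambda> y)"
    "Phi \<Lambda> (msum_mult x y) = msum_mult (Phi \<Lambda> x) (Phi \<Lambda> y)"
    "Phi \<Lambda> (msum_smult c x) = msum_smult c (Phi \<Lambda> x)"
    "Phi \<Lambda> (msum_star x) = msum_star (Phi \<Lambda> x)"
    using x y
    by (auto intro!: msum_eqI[of _ ns] closed msum_closed simp: msum_op_nth[of _ ns] closed)
qed

section \<open>Multiplicity free subalgebras\<close>

text \<open>The test matrix has the distinct diagonal entries 0, ..., n-1, so comparing entries at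
  \<open>(p, q)\<close> shows that \<open>a $$ (p, q)\<close> times q - p vanishes.\<close>

lemma commute_diagonal:
  fixes a :: "complex mat"
  assumes a: "a \<in> carrier_mat n n"
    and comm: "a * mat n n (\<lambda>(p, q). if p = q then of_nat p else 0) =
      mat n n (\<lambda>(p, q). if p = q then of_nat p else 0) * a"
  shows "a = mat n n (\<lambda>(p, q). if p = q then a $$ (p, p) else 0)"
proof (rule eq_matI)
  let ?D = "mat n n (\<lambda>(p, q). if p = q then of_nat p else 0) :: complex mat"
  fix p q assume "p < dim_row (mat n n (\<lambda>(p, q). if p = q then a $$ (p, p) else 0))"
    "q < dim_col (mat n n (\<lambda>(p, q). if p = q then a $$ (p, p) else 0))"
  then have pq: "p < n" "q < n" by auto
  have "(a * ?D) $$ (p, q) = (\<Sum>i = 0..<n. a $$ (p, i) * (if i = q then of_nat i else 0))"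
    using a pq by (simp add: scalar_prod_def)
  also have "\<dots> = a $$ (p, q) * of_nat q"
    using pq by (simp add: if_distrib[of "\<lambda>x. _ * x"] cong: if_cong)
  finally have "(a * ?D) $$ (p, q) = a $$ (p, q) * of_nat q" .
  moreover have "(?D * a) $$ (p, q) = (\<Sum>i = 0..<n. (if p = i then of_nat p else 0) * a $$ (i, q))"
    using a pq by (simp add: scalar_prod_def)
  moreover have "\<dots> = of_nat p * a $$ (p, q)"
    using pq by (simp add: if_distrib[of "\<lambda>x. x * _"] cong: if_cong)
  ultimately have "a $$ (p, q) * of_nat q = of_nat p * a $$ (p, q)"
    using comm by metis
  then have "a $$ (p, q) * (of_nat q - of_nat p) = 0" by (simp only: algebra_simps) simp
  then show "a $$ (p, q) = mat n n (\<lambda>(p, q). if p = q then a $$ (p, p) else 0) $$ (p, q)"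
    using pq by auto
qed (use a in auto)

text \<open>A diagonal matrix can be cut along any prescribed block sizes, including 0. The blocks
  are given by a function of the index, to match the shape of \<open>Phi\<close>; distinctness lets
  the induction set the value at the head without disturbing the later ones.\<close>

lemma diagonal_conv_diag_block_mat:
  fixes g :: "nat \<Rightarrow> complex"
  assumes "distinct js"
  shows "\<exists>f. (\<forall>j\<in>set js. f j \<in> carrier_mat (d j) (d j)) \<and>
    mat (\<Sum>j\<leftarrow>js. d j) (\<Sum>j\<leftarrow>js. d j) (\<lambda>(p, q). if p = q then g p else 0) =
      diag_block_mat (map f js)"
  using assms
proof (induction js arbitrary: g)
  case Nil
  show ?case by (auto intro!: exI[of _ "\<lambda>_. 0\<^sub>m 0 0"] eq_matI)
next
  case (Cons a js)
  let ?s = "\<Sum>j\<leftarrow>js. d j" and ?E = "mat (d a) (d a) (\<lambda>(p, q). if p = q then g p else 0)"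
  from Cons.prems Cons.IH[of "\<lambda>p. g (d a + p)"] obtain f
    where f: "\<forall>j\<in>set js. f j \<in> carrier_mat (d j) (d j)"
    and eq: "mat ?s ?s (\<lambda>(p, q). if p = q then g (d a + p) else 0) = diag_block_mat (map f js)"
    by auto
  have "map (f(a := ?E)) (a # js) = ?E # map f js"
    using Cons.prems by auto
  then have "diag_block_mat (map (f(a := ?E)) (a # js)) =
      four_block_mat ?E (0\<^sub>m (d a) ?s) (0\<^sub>m ?s (d a))
        (mat ?s ?s (\<lambda>(p, q). if p = q then g (d a + p) else 0))"
    by (simp only: diag_block_mat.simps Let_def eq[symmetric] dim_row_mat dim_col_mat)
  also have "\<dots> = mat (\<Sum>j\<leftarrow>a # js. d j) (\<Sum>j\<leftarrow>a # js. d j) (\<lambda>(p, q). if p = q then g p else 0)"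
    by (intro eq_matI) auto
  finally have eq': "diag_block_mat (map (f(a := ?E)) (a # js)) =
      mat (\<Sum>j\<leftarrow>a # js. d j) (\<Sum>j\<leftarrow>a # js. d j) (\<lambda>(p, q). if p = q then g p else 0)" .
  show ?case
  proof (intro exI conjI)
    show "\<forall>j\<in>set (a # js). (f(a := ?E)) j \<in> carrier_mat (d j) (d j)" using f by simp
  qed (rule eq'[symmetric])
qed

text \<open>A column of \<open>\<Lambda>\<close> is nonzero with sum at most 1, so it has a single
  entry 1. Thus every component of an element of \<open>msum ds\<close> shows up in exactly one
  place, and all blocks of the image can be prescribed independently.\<close>

lemma diagonal_in_range_Phi:
  fixes g :: "nat \<Rightarrow> nat \<Rightarrow> complex"
  assumes inc: "inclusion_matrix \<Lambda> ds ns" and mf: "multiplicity_free_matrix \<Lambda>"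
  shows "map (\<lambda>i. mat (ns ! i) (ns ! i) (\<lambda>(p, q). if p = q then g i p else 0)) [0..<length ns]
    \<in> Phi \<Lambda> ` msum ds"
proof -
  let ?l = "length ns" and ?k = "length ds"
  have \<Lambda>: "dim_row \<Lambda> = ?l" "dim_col \<Lambda> = ?k"
    and cols: "\<And>j. j < ?k \<Longrightarrow> col \<Lambda> j \<noteq> 0\<^sub>v ?l"
    using inc by (auto simp: inclusion_matrix_def)
  have "\<exists>f. (\<forall>j<?k. f j \<in> carrier_mat (\<Lambda> $$ (i, j) * ds ! j) (\<Lambda> $$ (i, j) * ds ! j)) \<and>
      mat (ns ! i) (ns ! i) (\<lambda>(p, q). if p = q then g i p else 0) = diag_block_mat (map f [0..<?k])"
    if "i < ?l" for i
    using diagonal_conv_diag_block_mat[of "[0..<?k]" "\<lambda>j. \<Lambda> $$ (i, j) * ds ! j" "g i"]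
    unfolding inclusion_matrix_row_sum[OF inc that]
    by (simp only: set_upt atLeast0LessThan Ball_def lessThan_iff distinct_upt simp_thms)
  then have "\<forall>i. \<exists>f. i < ?l \<longrightarrow>
      (\<forall>j<?k. f j \<in> carrier_mat (\<Lambda> $$ (i, j) * ds ! j) (\<Lambda> $$ (i, j) * ds ! j)) \<and>
      mat (ns ! i) (ns ! i) (\<lambda>(p, q). if p = q then g i p else 0) = diag_block_mat (map f [0..<?k])"
    by blast
  from choice[OF this] obtain f where fc: "\<And>i j. i < ?l \<Longrightarrow> j < ?k \<Longrightarrow>
      f i j \<in> carrier_mat (\<Lambda> $$ (i, j) * ds ! j) (\<Lambda> $$ (i, j) * ds ! j)"
    and f: "\<And>i. i < ?l \<Longrightarrow> mat (ns ! i) (ns ! i) (\<lambda>(p, q). if p = q then g i p else 0) =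
      diag_block_mat (map (f i) [0..<?k])"
    by blast
  have "\<exists>i<?l. \<Lambda> $$ (i, j) = 1 \<and> (\<forall>i'<?l. i' \<noteq> i \<longrightarrow> \<Lambda> $$ (i', j) = 0)" if j: "j < ?k" for j
  proof -
    have "\<exists>i<?l. \<Lambda> $$ (i, j) \<noteq> 0"
    proof (rule ccontr)
      assume "\<not> ?thesis"
      then have "col \<Lambda> j = 0\<^sub>v ?l" using \<Lambda> j by (intro eq_vecI) auto
      with cols[OF j] show False by simp
    qed
    then obtain i where i: "i < ?l" "\<Lambda> $$ (i, j) \<noteq> 0" by blast
    have "(\<Sum>i<?l. \<Lambda> $$ (i, j)) \<le> 1"
      using mf j \<Lambda> by (simp add: multiplicity_free_matrix_def)
    then have sum: "\<Lambda> $$ (i, j) + (\<Sum>i\<in>{..<?l} - {i}. \<Lambda> $$ (i, j)) \<le> 1"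
      using i(1) by (simp add: sum.remove[of "{..<?l}" i])
    with i(2) have "\<Lambda> $$ (i, j) = 1" "(\<Sum>i\<in>{..<?l} - {i}. \<Lambda> $$ (i, j)) = 0" by linarith+
    with i(1) show ?thesis by (intro exI[of _ i]) auto
  qed
  \<comment> \<open>\<open>own j\<close> is the one summand in which block \<open>j\<close>
    sits.\<close>
  then obtain own where own: "\<And>j. j < ?k \<Longrightarrow> own j < ?l" "\<And>j. j < ?k \<Longrightarrow> \<Lambda> $$ (own j, j) = 1"
    "\<And>i j. j < ?k \<Longrightarrow> i < ?l \<Longrightarrow> i \<noteq> own j \<Longrightarrow> \<Lambda> $$ (i, j) = 0"
    by metis
  define xs where "xs = map (\<lambda>j. f (own j) j) [0..<?k]"
  have "f (own j) j \<in> carrier_mat (ds ! j) (ds ! j)" if "j < ?k" for j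
    using fc[OF own(1)[OF that] that] own(2)[OF that] by simp
  then have "xs \<in> msum ds" by (simp add: msum_iff xs_def)
  moreover have "Phi \<Lambda> xs =
    map (\<lambda>i. mat (ns ! i) (ns ! i) (\<lambda>(p, q). if p = q then g i p else 0)) [0..<?l]"
  proof (rule nth_equalityI)
    fix i assume "i < length (Phi \<Lambda> xs)"
    then have i: "i < ?l" by (simp add: Phi_def \<Lambda>)
    have "amplify (xs ! j) (\<Lambda> $$ (i, j)) = f i j" if j: "j < ?k" for j
    proof (cases "i = own j")
      case True
      with j show ?thesis by (simp add: own(2) amplify_def xs_def del: diag_block_mat.simps)
    next
      case False
      then have "\<Lambda> $$ (i, j) = 0" using own(3) i j by blast
      \<comment> \<open>Both sides are 0 x 0 matrices, since the size of \<open>f i j\<close> has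
        the factor \<open>\<Lambda> $$ (i, j)\<close>.\<close>
      with fc[OF i j] show ?thesis by (auto simp: amplify_def intro: eq_matI)
    qed
    then have "map (\<lambda>j. amplify (xs ! j) (\<Lambda> $$ (i, j))) [0..<?k] = map (f i) [0..<?k]" by simp
    then have "Phi \<Lambda> xs ! i = mat (ns ! i) (ns ! i) (\<lambda>(p, q). if p = q then g i p else 0)"
      using i f[OF i] by (simp only: Phi_nth \<Lambda>)
    then show "Phi \<Lambda> xs ! i = map (\<lambda>i. mat (ns ! i) (ns ! i)
        (\<lambda>(p, q). if p = q then g i p else 0)) [0..<?l] ! i"
      using i by (subst nth_map_upt) (simp_all only: add_0 diff_zero)
  qed (simp add: Phi_def \<Lambda>)
  ultimately show ?thesis by (metis imageI)
qed

lemma multiplicity_free_imp_commutant_subset: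
  assumes B: "unital_cstar_subalgebra ns B" and mf: "multiplicity_free_subalgebra ns B"
  shows "relative_commutant B (msum ns) \<subseteq> B"
proof
  fix a assume "a \<in> relative_commutant B (msum ns)"
  then have a: "a \<in> msum ns" and comm: "\<And>b. b \<in> B \<Longrightarrow> msum_mult a b = msum_mult b a"
    by (auto simp: relative_commutant_def)
  have BA: "B \<subseteq> msum ns" using B by (simp add: unital_cstar_subalgebra_def)
  obtain u ds \<Lambda> where u: "msum_unitary ns u" and inc: "inclusion_matrix \<Lambda> ds ns"
    and mfm: "multiplicity_free_matrix \<Lambda>" and img: "msum_conj u ` B = Phi \<Lambda> ` msum ds"
    using mf unfolding multiplicity_free_subalgebra_def msum_conj_def[symmetric] by blast
  let ?diag = "\<lambda>g. map (\<lambda>i. mat (ns ! i) (ns ! i) (\<lambda>(p, q). if p = q then g i p else 0 :: complex))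
    [0..<length ns]"
  define a' where "a' = msum_conj u a"
  have a': "a' \<in> msum ns" unfolding a'_def using u a by (rule msum_conj_closed)
  \<comment> \<open>One element suffices to force \<open>a'\<close> to be diagonal: in each summand
    its diagonal entries 0, 1, 2, ... are distinct.\<close>
  obtain b where b: "b \<in> B" "?diag (\<lambda>_. of_nat) = msum_conj u b"
    using diagonal_in_range_Phi[OF inc mfm, of "\<lambda>_. of_nat"] unfolding img[symmetric] by blast
  have bA: "b \<in> msum ns" using b(1) BA by blast
  have "msum_mult a' (?diag (\<lambda>_. of_nat)) = msum_mult (?diag (\<lambda>_. of_nat)) a'"
    unfolding b(2) a'_def using msum_conj_mult[OF u] a bA comm[OF b(1)] by metis
  moreover have dA: "?diag (\<lambda>_. of_nat) \<in> msum ns" by (simp add: msum_iff)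
  ultimately have eq: "a' ! i * ?diag (\<lambda>_. of_nat) ! i = ?diag (\<lambda>_. of_nat) ! i * a' ! i"
    if "i < length ns" for i
    using msum_op_nth(2)[OF a' that dA] msum_op_nth(2)[OF dA that a'] by metis
  have diag_nth: "?diag g ! i = mat (ns ! i) (ns ! i) (\<lambda>(p, q). if p = q then g i p else 0)"
    if "i < length ns" for g i
    using that by (subst nth_map_upt) (simp_all only: add_0 diff_zero)
  have "a' = ?diag (\<lambda>i p. a' ! i $$ (p, p))"
  proof (rule nth_equalityI)
    fix i assume "i < length a'"
    then have i: "i < length ns" using a' by (simp add: msum_iff)
    then show "a' ! i = ?diag (\<lambda>i p. a' ! i $$ (p, p)) ! i"
      using commute_diagonal[OF msum_nth[OF a' i]] eq[OF i] unfolding diag_nth[OF i] by blast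
  qed (use a' in \<open>simp add: msum_iff\<close>)
  \<comment> \<open>The range of \<open>Phi\<close> is used a second time, now for the diagonal of
    \<open>a'\<close> itself.\<close>
  then have "a' \<in> msum_conj u ` B"
    using diagonal_in_range_Phi[OF inc mfm, of "\<lambda>i p. a' ! i $$ (p, p)"] unfolding img by simp
  then obtain c where c: "c \<in> B" "msum_conj u a = msum_conj u c" by (auto simp: a'_def)
  then have "a = c" using msum_conj_inverse[OF u] a BA by (metis subsetD)
  with c show "a \<in> B" by simp
qed

section \<open>Assembling the blocks of all summands into one multiplicity free matrix\<close>

lemma diag_block_mat_filter:
  "diag_block_mat (map (\<lambda>p. if Q p then h p else 0\<^sub>m 0 0) ps) = diag_block_mat (map h (filter Q ps))"
proof (induction ps)
  case (Cons p ps)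
  let ?M = "diag_block_mat (map h (filter Q ps))"
  have "four_block_mat (0\<^sub>m 0 0) (0\<^sub>m 0 (dim_col ?M)) (0\<^sub>m (dim_row ?M) 0) ?M = ?M"
    by (intro eq_matI) auto
  with Cons show ?case by (simp add: Let_def)
qed simp

text \<open>The pairs are grouped by first component, so selecting one value recovers its list with
  the order intact. The order matters for a block diagonal matrix.\<close>

lemma filter_fst_concat:
  "filter (\<lambda>p. fst p = i) (concat (map (\<lambda>i. map (Pair i) (g i)) [0..<l])) =
    (if i < l then map (Pair i) (g i) else [])"
proof (induction l)
  case (Suc l)
  have "filter (\<lambda>p. fst p = i) (map (Pair l) (g l)) = (if i = l then map (Pair l) (g l) else [])"
    by (auto simp: filter_map comp_def)
  with Suc show ?case by (auto simp: less_Suc_eq)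
qed simp

lemma sum_list_map_indicator:
  "(\<Sum>p\<leftarrow>ps. if Q p then h p else 0) = sum_list (map h (filter Q ps))"
  by (induction ps) auto

text \<open>\<open>idx\<close> numbers all pairs of a summand and a block in it. Each pair has its
  own column of \<open>\<Lambda>\<close>, with the 1 in the row of its summand, so no block is ever
  repeated and \<open>Phi \<Lambda>\<close> merely places the blocks of each summand along its
  diagonal.\<close>

lemma block_index_inclusion:
  fixes dss :: "nat \<Rightarrow> nat list"
  assumes dss: "\<And>i. i < length ns \<Longrightarrow> dss i \<noteq> [] \<and> (\<forall>d\<in>set (dss i). 1 \<le> d) \<and> sum_list (dss i) = ns ! i"
    and ns: "ns \<noteq> []"
  defines "idx \<equiv> concat (map (\<lambda>i. map (Pair i) [0..<length (dss i)]) [0..<length ns])"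
  defines "ds \<equiv> map (\<lambda>(i, j). dss i ! j) idx"
  defines "\<Lambda> \<equiv> mat (length ns) (length idx) (\<lambda>(i, j). if fst (idx ! j) = i then 1 else 0)"
  shows "dim_vector ds" "inclusion_matrix \<Lambda> ds ns" "multiplicity_free_matrix \<Lambda>"
    "Phi \<Lambda> (map (\<lambda>(i, j). Y i j) idx) =
      map (\<lambda>i. diag_block_mat (map (Y i) [0..<length (dss i)])) [0..<length ns]"
proof -
  let ?l = "length ns" and ?k = "length idx"
  have set_idx: "set idx = {(i, j). i < ?l \<and> j < length (dss i)}"
    by (auto simp: idx_def)
  have filter_idx: "filter (\<lambda>p. fst p = i) idx = map (Pair i) [0..<length (dss i)]" if "i < ?l" for i
    using that unfolding idx_def filter_fst_concat by simp
  have idx_nth: "fst (idx ! j) < ?l" "snd (idx ! j) < length (dss (fst (idx ! j)))" if "j < ?k" for j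
    using nth_mem[OF that] unfolding set_idx by auto
  have idx_ex: "\<exists>j<?k. fst (idx ! j) = i" if "i < ?l" for i
  proof -
    have "(i, 0) \<in> set idx" using that dss[OF that] by (simp add: set_idx)
    then show ?thesis by (metis fst_conv in_set_conv_nth)
  qed
  have len: "length ds = ?k" by (simp add: ds_def)
  show "dim_vector ds"
    unfolding dim_vector_def
  proof (intro conjI ballI)
    have "0 < ?k" using idx_ex[of 0] ns by auto
    then show "ds \<noteq> []" using len by auto
    fix d assume "d \<in> set ds"
    then obtain i j where "i < ?l" "j < length (dss i)" "d = dss i ! j"
      by (auto simp: ds_def set_idx)
    then show "1 \<le> d" using dss by auto
  qed
  show "multiplicity_free_matrix \<Lambda>"
    by (auto simp: multiplicity_free_matrix_def \<Lambda>_def)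
  show "inclusion_matrix \<Lambda> ds ns"
    unfolding inclusion_matrix_def
  proof (intro conjI allI impI)
    show "\<Lambda> \<in> carrier_mat ?l (length ds)" by (simp add: \<Lambda>_def len)
  next
    fix i assume i: "i < ?l"
    then obtain j where j: "j < ?k" "fst (idx ! j) = i" using idx_ex by blast
    show "row \<Lambda> i \<noteq> 0\<^sub>v (length ds)"
    proof
      assume "row \<Lambda> i = 0\<^sub>v (length ds)"
      then have "row \<Lambda> i $ j = 0\<^sub>v (length ds) $ j" by simp
      with i j show False by (simp add: \<Lambda>_def len)
    qed
  next
    fix j assume "j < length ds"
    then have j: "j < ?k" by (simp add: len)
    show "col \<Lambda> j \<noteq> 0\<^sub>v ?l"
    proof
      assume "col \<Lambda> j = 0\<^sub>v ?l"
      then have "col \<Lambda> j $ fst (idx ! j) = 0\<^sub>v ?l $ fst (idx ! j)" by simp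
      with j idx_nth[OF j] show False by (simp add: \<Lambda>_def)
    qed
  next
    show "\<Lambda> *\<^sub>v vec_of_list ds = vec_of_list ns"
    proof (rule eq_vecI)
      fix i assume "i < dim_vec (vec_of_list ns)"
      then have i: "i < ?l" by simp
      let ?h = "\<lambda>p. if fst p = i then dss (fst p) ! snd p else 0"
      have "(\<Lambda> *\<^sub>v vec_of_list ds) $ i = (\<Sum>j = 0..<?k. ?h (idx ! j))"
        using i by (auto simp: \<Lambda>_def scalar_prod_def ds_def vec_of_list_index split_beta
            intro!: sum.cong)
      also have "\<dots> = (\<Sum>p\<leftarrow>idx. ?h p)"
        by (simp add: sum_list_sum_nth)
      also have "\<dots> = (\<Sum>j\<leftarrow>[0..<length (dss i)]. dss i ! j)"
        unfolding sum_list_map_indicator filter_idx[OF i] by (simp add: comp_def)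
      also have "\<dots> = ns ! i" using dss[OF i] by (simp add: map_nth)
      finally show "(\<Lambda> *\<^sub>v vec_of_list ds) $ i = vec_of_list ns $ i"
        by (simp add: vec_of_list_index)
    qed (simp add: \<Lambda>_def)
  qed
  show "Phi \<Lambda> (map (\<lambda>(i, j). Y i j) idx) =
      map (\<lambda>i. diag_block_mat (map (Y i) [0..<length (dss i)])) [0..<length ns]"
  proof (rule nth_equalityI)
    fix i assume "i < length (Phi \<Lambda> (map (\<lambda>(i, j). Y i j) idx))"
    then have i: "i < ?l" by (simp add: Phi_def \<Lambda>_def)
    let ?xs = "map (\<lambda>(i, j). Y i j) idx"
    \<comment> \<open>A zero entry of \<open>\<Lambda>\<close> produces the 0 x 0 matrix, which
      \<open>diag_block_mat\<close> absorbs; an entry 1 leaves the block as it is.\<close>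
    have "map (\<lambda>j. amplify (?xs ! j) (\<Lambda> $$ (i, j))) [0..<?k] =
        map (\<lambda>p. if fst p = i then Y (fst p) (snd p) else 0\<^sub>m 0 0) idx"
      using i by (intro nth_equalityI)
        (auto simp: \<Lambda>_def amplify_def split_beta simp del: diag_block_mat.simps(2))
    then have "Phi \<Lambda> ?xs ! i = diag_block_mat (map (\<lambda>p. Y (fst p) (snd p)) (filter (\<lambda>p. fst p = i) idx))"
      using i by (simp add: Phi_nth \<Lambda>_def diag_block_mat_filter)
    also have "\<dots> = diag_block_mat (map (Y i) [0..<length (dss i)])"
      unfolding filter_idx[OF i] by (simp add: comp_def)
    finally show "Phi \<Lambda> ?xs ! i =
        map (\<lambda>i. diag_block_mat (map (Y i) [0..<length (dss i)])) [0..<length ns] ! i"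
      using i by simp
  qed (simp add: Phi_def \<Lambda>_def)
qed

text \<open>By \<open>irr\<close> each component of \<open>B\<close> is a full matrix algebra, but
  this alone is not enough: in two equal summands, the elements \<open>[x, x]\<close> have full
  components without filling the sum. The units of the summands cut the components apart.\<close>

lemma unital_cstar_subalgebra_full:
  assumes B: "unital_cstar_subalgebra ds B"
    and central: "\<And>j. j < length ds \<Longrightarrow>
      map (\<lambda>t. if t = j then 1\<^sub>m (ds ! t) else 0\<^sub>m (ds ! t) (ds ! t)) [0..<length ds] \<in> B"
    and irr: "\<And>j T. j < length ds \<Longrightarrow> T \<in> carrier_mat (ds ! j) (ds ! j) \<Longrightarrow>
      (\<And>x. x \<in> B \<Longrightarrow> T * (x ! j) = x ! j * T) \<Longrightarrow> \<exists>c. T = c \<cdot>\<^sub>m 1\<^sub>m (ds ! j)"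
  shows "B = msum ds"
proof
  show BA: "B \<subseteq> msum ds" using B by (simp add: unital_cstar_subalgebra_def)
  have one: "msum_one ds \<in> B" and add: "\<And>x y. x \<in> B \<Longrightarrow> y \<in> B \<Longrightarrow> msum_add x y \<in> B"
    and smult: "\<And>c x. x \<in> B \<Longrightarrow> msum_smult c x \<in> B"
    and mult: "\<And>x y. x \<in> B \<Longrightarrow> y \<in> B \<Longrightarrow> msum_mult x y \<in> B"
    and star: "\<And>x. x \<in> B \<Longrightarrow> msum_star x \<in> B"
    using B by (auto simp: unital_cstar_subalgebra_def)
  have full: "(\<lambda>x. x ! j) ` B = carrier_mat (ds ! j) (ds ! j)" if j: "j < length ds" for j
  proof (rule irreducible_star_algebra_full)
    show "(\<lambda>x. x ! j) ` B \<subseteq> carrier_mat (ds ! j) (ds ! j)"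
      using BA j by (auto intro: msum_nth)
    show "1\<^sub>m (ds ! j) \<in> (\<lambda>x. x ! j) ` B"
      using one msum_one_nth[OF j] by (metis imageI)
    show "\<exists>c. T = c \<cdot>\<^sub>m 1\<^sub>m (ds ! j)" if "T \<in> carrier_mat (ds ! j) (ds ! j)"
      "\<And>x. x \<in> (\<lambda>x. x ! j) ` B \<Longrightarrow> T * x = x * T" for T
      using irr[OF j that(1)] that(2) by blast
    fix x y c assume "x \<in> (\<lambda>x. x ! j) ` B"
    then obtain x' where x: "x' \<in> B" "x = x' ! j" by blast
    have xm: "x' \<in> msum ds" using x BA by blast
    show "c \<cdot>\<^sub>m x \<in> (\<lambda>x. x ! j) ` B" "mat_adjoint x \<in> (\<lambda>x. x ! j) ` B"
      using smult[OF x(1), of c] star[OF x(1)] msum_op_nth(3,4)[OF xm j] x(2) by (metis imageI)+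
    assume "y \<in> (\<lambda>x. x ! j) ` B"
    then obtain y' where y: "y' \<in> B" "y = y' ! j" by blast
    have ym: "y' \<in> msum ds" using y BA by blast
    show "x + y \<in> (\<lambda>x. x ! j) ` B" "x * y \<in> (\<lambda>x. x ! j) ` B"
      using add[OF x(1) y(1)] mult[OF x(1) y(1)] msum_op_nth(1,2)[OF xm j ym] x(2) y(2)
      by (metis imageI)+
  qed
  show "msum ds \<subseteq> B"
  proof
    fix y assume y: "y \<in> msum ds"
    let ?k = "length ds" and ?z = "\<lambda>t. 0\<^sub>m (ds ! t) (ds ! t) :: complex mat"
    \<comment> \<open>Induction on the number \<open>m\<close> of components already filled in, the
      others being 0. The next one comes from an element of \<open>B\<close> with the right
      component \<open>m\<close>, cut down by the unit of that summand.\<close>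
    have "map (\<lambda>t. if t < m then y ! t else ?z t) [0..<?k] \<in> B" if "m \<le> ?k" for m
      using that
    proof (induction m)
      case 0
      have "map (\<lambda>t. if t < 0 then y ! t else ?z t) [0..<?k] = msum_smult 0 (msum_one ds)"
        by (intro nth_equalityI) (auto simp: msum_smult_def msum_one_def)
      with smult[OF one] show ?case by metis
    next
      case (Suc m)
      let ?p = "map (\<lambda>t. if t < m then y ! t else ?z t) [0..<?k]"
      let ?q = "map (\<lambda>t. if t = m then 1\<^sub>m (ds ! t) else ?z t) [0..<?k]"
      have m: "m < ?k" and p: "?p \<in> B" using Suc by auto
      obtain x where x: "x \<in> B" "x ! m = y ! m"
        using full[OF m] msum_nth[OF y m] by (metis imageE)
      have xm: "x \<in> msum ds" using x BA by blast
      have qx: "msum_mult ?q x \<in> B" using central[OF m] x(1) by (rule mult)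
      have "map (\<lambda>t. if t < Suc m then y ! t else ?z t) [0..<?k] = msum_add ?p (msum_mult ?q x)"
      proof (rule msum_eqI)
        show "msum_add ?p (msum_mult ?q x) \<in> msum ds" using add[OF p qx] BA by blast
        show "map (\<lambda>t. if t < Suc m then y ! t else ?z t) [0..<?k] \<in> msum ds"
          using y by (simp add: msum_iff)
        fix t assume t: "t < ?k"
        have "msum_add ?p (msum_mult ?q x) ! t = ?p ! t + ?q ! t * x ! t"
          using t p qx central[OF m] xm BA by (simp add: msum_op_nth[of _ ds] subsetD)
        then show "map (\<lambda>t. if t < Suc m then y ! t else ?z t) [0..<?k] ! t =
            msum_add ?p (msum_mult ?q x) ! t"
          using t msum_nth[OF y t] msum_nth[OF xm t] x(2) by (auto simp: less_Suc_eq)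
      qed
      with add[OF p qx] show ?case by metis
    qed
    from this[of ?k] have "map (\<lambda>t. if t < ?k then y ! t else ?z t) [0..<?k] \<in> B" by simp
    moreover have "map (\<lambda>t. if t < ?k then y ! t else ?z t) [0..<?k] = y"
      using msum_length[OF y] by (intro nth_equalityI) auto
    ultimately show "y \<in> B" by simp
  qed
qed

text \<open>The choice of bases puts the conjugate of \<open>B\<close> inside the range of
  \<open>Phi \<Lambda>\<close>. Equality is obtained by pulling \<open>B\<close> back to a
  subalgebra of \<open>msum ds\<close> and showing that the latter is everything.\<close>

lemma commutant_subset_imp_multiplicity_free:
  assumes ns: "dim_vector ns" and B: "unital_cstar_subalgebra ns B"
    and comm: "relative_commutant B (msum ns) \<subseteq> B"
  shows "multiplicity_free_subalgebra ns B"
proof -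
  let ?l = "length ns"
  have BA: "B \<subseteq> msum ns" and one: "msum_one ns \<in> B"
    and add: "\<And>x y. x \<in> B \<Longrightarrow> y \<in> B \<Longrightarrow> msum_add x y \<in> B"
    and smult: "\<And>c x. x \<in> B \<Longrightarrow> msum_smult c x \<in> B"
    and mult: "\<And>x y. x \<in> B \<Longrightarrow> y \<in> B \<Longrightarrow> msum_mult x y \<in> B"
    and star: "\<And>x. x \<in> B \<Longrightarrow> msum_star x \<in> B"
    using B by (auto simp: unital_cstar_subalgebra_def)
  \<comment> \<open>A single predicate, so that the decompositions of all summands can be chosen at
    once.\<close>
  define D where "D i U ds F \<longleftrightarrow>
    unitary_mat (ns ! i) U \<and> ds \<noteq> [] \<and> (\<forall>d\<in>set ds. 1 \<le> d) \<and> sum_list ds = ns ! i \<and>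
    (\<forall>x\<in>(\<lambda>b. b ! i) ` B. F x \<in> msum ds \<and> U * x * mat_adjoint U = diag_block_mat (F x)) \<and>
    (\<forall>j<length ds. \<forall>T\<in>carrier_mat (ds ! j) (ds ! j).
      (\<forall>x\<in>(\<lambda>b. b ! i) ` B. T * (F x ! j) = F x ! j * T) \<longrightarrow> (\<exists>c. T = c \<cdot>\<^sub>m 1\<^sub>m (ds ! j)))"
    for i U ds F
  have "\<exists>U ds F. D i U ds F" if i: "i < ?l" for i
    unfolding D_def
  proof (rule irreducible_decomposition)
    show "(\<lambda>b. b ! i) ` B \<subseteq> carrier_mat (ns ! i) (ns ! i)" using BA i by (auto intro: msum_nth)
    fix x assume "x \<in> (\<lambda>b. b ! i) ` B"
    then obtain b where b: "b \<in> B" "x = b ! i" by blast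
    then have "mat_adjoint x = msum_star b ! i" using msum_op_nth(4)[of b ns i] BA i by auto
    then show "mat_adjoint x \<in> (\<lambda>b. b ! i) ` B" using star[OF b(1)] by blast
  qed (use ns i in \<open>auto simp: dim_vector_def Suc_le_eq\<close>)
  then obtain U dss F where D: "\<And>i. i < ?l \<Longrightarrow> D i (U i) (dss i) (F i)" by metis
  have U: "unitary_mat (ns ! i) (U i)"
    and dss: "dss i \<noteq> [] \<and> (\<forall>d\<in>set (dss i). 1 \<le> d) \<and> sum_list (dss i) = ns ! i" if "i < ?l" for i
    using D[OF that] by (auto simp: D_def)
  have F: "F i (b ! i) \<in> msum (dss i)"
    and UF: "U i * b ! i * mat_adjoint (U i) = diag_block_mat (F i (b ! i))"
    if "i < ?l" "b \<in> B" for i b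
    using D[OF that(1)] that(2) by (auto simp: D_def)
  have irr: "\<exists>c. T = c \<cdot>\<^sub>m 1\<^sub>m (dss i ! j)"
    if "i < ?l" "j < length (dss i)" "T \<in> carrier_mat (dss i ! j) (dss i ! j)"
      "\<And>b. b \<in> B \<Longrightarrow> T * (F i (b ! i) ! j) = F i (b ! i) ! j * T" for i j T
    using D[OF that(1)] that(2-4) by (auto simp: D_def)
  define idx where "idx = concat (map (\<lambda>i. map (Pair i) [0..<length (dss i)]) [0..<?l])"
  define ds where "ds = map (\<lambda>(i, j). dss i ! j) idx"
  define \<Lambda> :: "nat mat"
    where "\<Lambda> = mat ?l (length idx) (\<lambda>(i, j). if fst (idx ! j) = i then 1 else 0)"
  have "ns \<noteq> []" using ns by (simp add: dim_vector_def)
  note block = block_index_inclusion[of ns dss, OF dss this, folded idx_def, folded ds_def \<Lambda>_def]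
  have dv: "dim_vector ds" and inc: "inclusion_matrix \<Lambda> ds ns"
    and mf: "multiplicity_free_matrix \<Lambda>"
    and Phi_idx: "\<And>Y. Phi \<Lambda> (map (\<lambda>(i, j). Y i j) idx) =
      map (\<lambda>i. diag_block_mat (map (Y i) [0..<length (dss i)])) [0..<?l]"
    by (rule block; simp)+
  have idx_nth: "fst (idx ! j) < ?l" "snd (idx ! j) < length (dss (fst (idx ! j)))"
    if "j < length ds" for j
    using nth_mem[of j idx] that by (auto simp: idx_def ds_def)
  define u where "u = map U [0..<?l]"
  have u: "msum_unitary ns u"
    using U by (auto simp: msum_unitary_iff u_def msum_iff unitary_mat_def)
  note u' = msum_star_unitary[OF u]
  \<comment> \<open>The blocks of \<open>b\<close> from all summands in the order of
    \<open>idx\<close>: a preimage under \<open>Phi \<Lambda>\<close> of the conjugate of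
    \<open>b\<close>.\<close>
  define G where "G b = map (\<lambda>(i, j). F i (b ! i) ! j) idx" for b
  have G: "G b \<in> msum ds" if b: "b \<in> B" for b
    using F[OF idx_nth(1) b] idx_nth by (auto simp: msum_iff G_def ds_def split_beta)
  have Phi_G: "Phi \<Lambda> (G b) = msum_conj u b" if b: "b \<in> B" for b
  proof (rule msum_eqI)
    have bA: "b \<in> msum ns" using b BA by blast
    show "Phi \<Lambda> (G b) \<in> msum ns" "msum_conj u b \<in> msum ns"
      using Phi_closed[OF inc G[OF b]] msum_conj_closed[OF u bA] by auto
    fix i assume i: "i < ?l"
    have "map (\<lambda>j. F i (b ! i) ! j) [0..<length (dss i)] = F i (b ! i)"
      using msum_length[OF F[OF i b]] by (metis map_nth)
    then have "Phi \<Lambda> (G b) ! i = diag_block_mat (F i (b ! i))"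
      using i by (simp add: G_def Phi_idx[of "\<lambda>i j. F i (b ! i) ! j"])
    also have "\<dots> = msum_conj u b ! i"
      unfolding msum_conj_nth[OF u bA i] using i UF[OF i b] by (simp add: u_def)
    finally show "Phi \<Lambda> (G b) ! i = msum_conj u b ! i" .
  qed
  \<comment> \<open>\<open>Phi \<Lambda>\<close> moved back to the original coordinates, so that
    \<open>\<psi> (G b) = b\<close> on \<open>B\<close>.\<close>
  define \<psi> where "\<psi> x = msum_conj (msum_star u) (Phi \<Lambda> x)" for x
  have \<psi>_closed: "\<psi> x \<in> msum ns" if "x \<in> msum ds" for x
    unfolding \<psi>_def using u' Phi_closed[OF inc that] by (rule msum_conj_closed)
  have \<psi>_add: "\<psi> (msum_add x y) = msum_add (\<psi> x) (\<psi> y)"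
    and \<psi>_mult: "\<psi> (msum_mult x y) = msum_mult (\<psi> x) (\<psi> y)"
    and \<psi>_smult: "\<psi> (msum_smult c x) = msum_smult c (\<psi> x)"
    and \<psi>_star: "\<psi> (msum_star x) = msum_star (\<psi> x)" if "x \<in> msum ds" "y \<in> msum ds" for x y c
    using msum_conj_hom[OF u' Phi_closed[OF inc that(1)] Phi_closed[OF inc that(2)]]
    by (simp_all add: \<psi>_def Phi_hom[OF inc that])
  have \<psi>_one: "\<psi> (msum_one ds) = msum_one ns"
    by (simp add: \<psi>_def Phi_one[OF inc] msum_conj_one[OF u'])
  have \<psi>_G: "\<psi> (G b) = b" if "b \<in> B" for b
    unfolding \<psi>_def Phi_G[OF that] using that BA by (intro msum_conj_inverse[OF u]) auto
  have u\<psi>: "msum_conj u (\<psi> x) = Phi \<Lambda> x" if "x \<in> msum ds" for x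
    using msum_conj_inverse[OF u' Phi_closed[OF inc that]] by (simp add: \<psi>_def msum_star_star)
  have "{x \<in> msum ds. \<psi> x \<in> B} = msum ds"
  proof (rule unital_cstar_subalgebra_full)
    show "unital_cstar_subalgebra ds {x \<in> msum ds. \<psi> x \<in> B}"
      using one add smult mult star
      by (auto simp: unital_cstar_subalgebra_def msum_one_closed msum_closed \<psi>_one \<psi>_add \<psi>_mult
          \<psi>_smult \<psi>_star)
  next
    fix j assume j: "j < length ds"
    define q where
      "q = map (\<lambda>t. if t = j then 1\<^sub>m (ds ! t) else 0\<^sub>m (ds ! t) (ds ! t) :: complex mat) [0..<length ds]"
    have q: "q \<in> msum ds" by (simp add: q_def msum_iff)
    \<comment> \<open>\<open>q\<close> is central in \<open>msum ds\<close>, and every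
      \<open>b\<close> in \<open>B\<close> equals \<open>\<psi> (G b)\<close>; so
      \<open>\<psi> q\<close> commutes with \<open>B\<close>. This is where the hypothesis on the
      relative commutant enters.\<close>
    have "msum_mult q x = msum_mult x q" if x: "x \<in> msum ds" for x
    proof (rule msum_eqI)
      fix t assume t: "t < length ds"
      have "q ! t * x ! t = x ! t * q ! t" using t msum_nth[OF x t] by (cases "t = j") (simp_all add: q_def)
      then show "msum_mult q x ! t = msum_mult x q ! t"
        using t q x by (simp add: msum_op_nth[of _ ds])
    qed (use q x in \<open>auto intro: msum_closed\<close>)
    then have "msum_mult (\<psi> q) b = msum_mult b (\<psi> q)" if b: "b \<in> B" for b
      using \<psi>_mult[OF q G[OF b]] \<psi>_mult[OF G[OF b] q] \<psi>_G[OF b] G[OF b] by metis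
    then have "\<psi> q \<in> B"
      using comm \<psi>_closed[OF q] by (auto simp: relative_commutant_def)
    with q show "map (\<lambda>t. if t = j then 1\<^sub>m (ds ! t) else 0\<^sub>m (ds ! t) (ds ! t)) [0..<length ds]
        \<in> {x \<in> msum ds. \<psi> x \<in> B}"
      by (simp add: q_def)
  next
    fix j T assume j: "j < length ds" and T: "T \<in> carrier_mat (ds ! j) (ds ! j)"
      and commT: "\<And>x. x \<in> {x \<in> msum ds. \<psi> x \<in> B} \<Longrightarrow> T * (x ! j) = x ! j * T"
    obtain i j' where ij: "idx ! j = (i, j')" by fastforce
    have ds_j: "ds ! j = dss i ! j'" using j ij by (simp add: ds_def)
    \<comment> \<open>\<open>G b\<close> belongs to the pulled-back algebra, so \<open>T\<close>
      commutes in particular with the corresponding blocks of all elements of \<open>B\<close>,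
      whose commutant is scalar by the decomposition.\<close>
    have "T * (F i (b ! i) ! j') = F i (b ! i) ! j' * T" if b: "b \<in> B" for b
    proof -
      have "G b ! j = F i (b ! i) ! j'" using j ij by (simp add: G_def ds_def)
      with commT[of "G b"] G[OF b] \<psi>_G[OF b] b show ?thesis by simp
    qed
    with irr[of i j' T] idx_nth[OF j] T show "\<exists>c. T = c \<cdot>\<^sub>m 1\<^sub>m (ds ! j)"
      by (simp add: ij ds_j)
  qed
  then have \<psi>B: "\<psi> x \<in> B" if "x \<in> msum ds" for x using that by blast
  have "msum_conj u ` B = Phi \<Lambda> ` msum ds"
  proof
    show "msum_conj u ` B \<subseteq> Phi \<Lambda> ` msum ds" using Phi_G G by (metis image_subset_iff imageI)
    show "Phi \<Lambda> ` msum ds \<subseteq> msum_conj u ` B" using u\<psi> \<psi>B by (metis image_subset_iff imageI)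
  qed
  with u dv inc mf show ?thesis
    unfolding multiplicity_free_subalgebra_def msum_conj_def[symmetric] by blast
qed

theorem proposition4p18:
  fixes ns :: "nat list" and B :: "complex mat list set"
  assumes "dim_vector ns"
    and "unital_cstar_subalgebra ns B"
  shows "relative_commutant B (msum ns) \<subseteq> B \<longleftrightarrow> multiplicity_free_subalgebra ns B"
  using assms commutant_subset_imp_multiplicity_free multiplicity_free_imp_commutant_subset by blast

end
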